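(* Suppose the error-dissipation condition holds (with constants $c_e,\mu,\nu$ and random variables $\mathcal E_k$), and that $0<\bar\alpha\le\min\{C_\alpha,1/(L_F+2L_R)\}$. Let $\{(x^k,\eta^k):k\in\mathbb N\}$ be generated by algorithm iRPMVR and let $\hat\eta^k$ be the exact tangent step. Define $\sigma_0:=\frac1{2\alpha}-\frac{L_F}2-L_R$. Then, for every $k\ge0$ and every $\tau>0$, $$\begin{aligned}\mathbb E_k[\Phi(x^{k+1})]\le{}&\Phi(x^k)-\Bigl(\sigma_0-\frac\tau2\Bigr)\gamma_k\mathbb E_k[\|\eta^k\|^2]-\frac{\gamma_k}{2\alpha}\mathbb E_k[\|\hat\eta^k\|^2]\\&+\frac{c_e}{2\tau}\bigl(\mathcal E_k-\mathbb E_k[\mathcal E_{k+1}]\bigr)-\frac\mu{2\tau}\mathcal E_k+\frac\nu{2\tau}\mathbb E_k[\|\eta^k\|^2]+2\ell_RC_0\Delta_k.\end{aligned}$$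
   Context: Setting. $\mathcal M\subseteq\mathbb R^d$ is a compact embedded Riemannian submanifold (induced Euclidean metric) of dimension $d-p$, with tangent spaces $T_x\mathcal M$, tangent bundle $T\mathcal M=\{(x,\eta):x\in\mathcal M,\eta\in T_x\mathcal M\}$; $P_S$ is Euclidean projection onto a closed convex set $S$. $\Phi=F+R$, $F=\frac1n\sum_{j=1}^nf_j$. Each $f_j:\mathbb R^d\to\mathbb R$ is $C^1$; there is an open neighborhood $U$ of $\mathcal M$ on which every $\nabla f_j$ is Lipschitz with common constant $\ell_f$; $\|\nabla f_j(x)\|\le M_f$ for all $x\in\mathcal M$ and all $j$ ($M_f>0$ independent of $n$); $R:\mathbb R^d\to\mathbb R$ is convex and $\ell_R$-Lipschitz. $\operatorname{grad}h(x)=P_{T_x\mathcal M}\nabla h(x)$. $\operatorname{Retr}:T\mathcal M\to\mathcal M$ is a retraction (smooth, $\operatorname{Retr}_x(0)=x$, $D\operatorname{Retr}_x(0)=\mathrm{Id}$). $\mathcal M$ is covered by finitely many open sets $V_\ell$ with $\overline{V_\ell}\subseteq U_\ell$, $U_\ell$ open carrying smooth local defining functions $\psi_\ell:U_\ell\to\mathbb R^p$ of $\mathcal M$ whose differential has full row rank on $U_\ell\cap\mathcal M$; for $x\in\mathcal M$ pick $\ell(x)$ with $x\in V_{\ell(x)}$ and set $B_x:=D\psi_{\ell(x)}(x)$, so $\ker B_x=T_x\mathcal M$. $C_0>0$ is a constant with $\operatorname{dist}(v,T_x\mathcal M)\le C_0\|B_xv\|$ for all $x\in\mathcal M$, $v\in\mathbb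 R^d$. Algorithm iRPMVR. Choose $x^0\in\mathcal M$, stepsize $0<\alpha\le\bar\alpha$, $0<\gamma\le1$, $\bar\Delta\ge0$, $0\le\bar\chi<1$, $M_u:=c_fM_f$ with $c_f\ge1$. Parameters $\gamma_k\in[\gamma,1]$, $\Delta_k\in[0,\bar\Delta]$, $\chi_k\in[0,\bar\chi]$ are chosen before sampling the $k$-th batch using only available history. Initialize $u^0=\hat u^0=\bar m^0=\operatorname{grad}F(x^0)$. For $k=0,1,\dots$: (a) if $k\ne0$, sample a random batch $\mathcal B_k$ from $\{1,\dots,n\}$, form from it and the current estimator state an estimator $u^k\in T_{x^k}\mathcal M$ of $\operatorname{grad}F(x^k)$, and set $\hat u^k=P_{\overline B(0,M_u)}u^k$; (b) $m^k=\chi_k\bar m^k+(1-\chi_k)\hat u^k$; (c) with $F_k(\eta):=\langle m^k,\eta\rangle+\frac1{2\alpha}\|\eta\|^2+R(x^k+\eta)$ and $G_k(\lambda):=F_k^*(-B_{x^k}^\top\lambda)$ ($F_k^*$ the Fenchel conjugate) find $\lambda^k\in\mathbb R^p$ with $\|\nabla G_k(\lambda^k)\|\le\Delta_k$; (d) $w^k=\operatorname{prox}_{\alpha R}(x^k-\alpha(m^k+B_{x^k}^\top\lambda^k))-x^k$, $\eta^k=P_{T_{x^k}\mathcal M}w^k$; (e) $x^{k+1}=\operatorname{Retr}_{x^k}(\gamma_k\eta^k)$; (f) $\bar m^{k+1}=P_{T_{x^{k+1}}\mathcal M}m^k$. The exact tangent step is $\hat\eta^k:=\arg\min_{\eta\in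 T_{x^k}\mathcal M}F_k(\eta)$ and $e^k:=m^k-\operatorname{grad}F(x^k)$. $\mathcal F_k$ is the natural filtration of the history before $\mathcal B_k$ is sampled (so $x^k,\bar m^k,\gamma_k,\Delta_k,\chi_k$ are $\mathcal F_k$-measurable); $\mathbb E_k=\mathbb E[\cdot\mid\mathcal F_k]$. Error-dissipation condition: there are constants $c_e,\mu,\nu>0$ and nonnegative $\mathcal F_k$-measurable random variables $\mathcal E_k$, $\mathbb E[\mathcal E_0]<\infty$, with $\mathbb E_k[\|e^k\|^2]+\mu\mathcal E_k\le c_e(\mathcal E_k-\mathbb E_k[\mathcal E_{k+1}])+\nu\mathbb E_k[\|\eta^k\|^2]$ for every $k\ge0$. Constants. $\delta,C_R,C_Q,L_R,L_\Phi,L_F>0$ are fixed such that for all $x\in\mathcal M$, $\eta\in T_x\mathcal M$, $\|\eta\|\le\delta$: $\|\operatorname{Retr}_x(\eta)-x\|\le C_R\|\eta\|$, $\|\operatorname{Retr}_x(\eta)-x-\eta\|\le C_Q\|\eta\|^2$, $|R(\operatorname{Retr}_x(\eta))-R(x+\eta)|\le L_R\|\eta\|^2$, $|\Phi(\operatorname{Retr}_x(\eta))-\Phi(x+\eta)|\le L_\Phi\|\eta\|^2$, $F(\operatorname{Retr}_x(\eta))-F(x)-\langle\operatorname{grad}F(x),\eta\rangle\le\frac{L_F}2\|\eta\|^2$. $\delta_T,L_T>0$ are fixed such that $\|\operatorname{grad}f_j(\operatorname{Retr}_x(\eta))-P_{T_{\operatorname{Retr}_x(\eta)}\mathcal M}\operatorname{grad}f_j(x)\|\le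 L_T\|\eta\|$ for all $j$, $x\in\mathcal M$, $\eta\in T_x\mathcal M$ with $\|\eta\|\le\delta_T$ (and likewise for $F$). Finally $$C_\alpha:=\left(\frac{\sqrt{\ell_RC_0\bar\Delta+(M_u+\ell_R)\min\{\delta,\delta_T\}}-\sqrt{\ell_RC_0\bar\Delta}}{M_u+\ell_R}\right)^2.$$ *)

theory Defs
  imports "HOL-Probability.Probability" "HOL-Library.Multiset"
begin

text \<open>
  \<^term>\<open>Ck_on\<close> is meant for open sets \<open>S\<close>: \<open>f\<close> is \<open>k\<close> times continuously differentiable on \<open>S\<close>.
  Continuity of the top directional derivatives gives continuity of the top total derivative
  because the domain has finite dimension.
\<close>

fun Ck_on :: "nat \<Rightarrow> 'a::euclidean_space set \<Rightarrow> ('a \<Rightarrow> 'b::euclidean_space) \<Rightarrow> bool" where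
  "Ck_on 0 S f \<longleftrightarrow> continuous_on S f"
| "Ck_on (Suc k) S f \<longleftrightarrow>
     (\<forall>x\<in>S. f differentiable (at x)) \<and> (\<forall>v. Ck_on k S (\<lambda>x. frechet_derivative f (at x) v))"

definition smooth_on :: "'a::euclidean_space set \<Rightarrow> ('a \<Rightarrow> 'b::euclidean_space) \<Rightarrow> bool" where
  "smooth_on S f \<longleftrightarrow> open S \<and> (\<forall>k. Ck_on k S f)"

text \<open>
  Smoothness of a map on a subset that need not be open (here: the tangent bundle, an embedded
  submanifold of the product space): existence of local smooth extensions.
\<close>

definition smooth_map_on :: "'a::euclidean_space set \<Rightarrow> ('a \<Rightarrow> 'b::euclidean_space) \<Rightarrow> bool" where
  "smooth_map_on A f \<longleftrightarrow>
     (\<forall>a\<in>A. \<exists>W g. a \<in> W \<and> smooth_on W g \<and> (\<forall>z\<in>W \<inter> A. g z = f z))"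

definition gradient :: "('a::euclidean_space \<Rightarrow> real) \<Rightarrow> 'a \<Rightarrow> 'a" where
  "gradient h x = (THE D. GDERIV h x :> D)"

definition local_defining_function ::
    "(real^'d) set \<Rightarrow> (real^'d) set \<Rightarrow> (real^'d \<Rightarrow> real^'p) \<Rightarrow> bool" where
  "local_defining_function M U \<psi> \<longleftrightarrow>
     smooth_on U \<psi> \<and> U \<inter> M = {x \<in> U. \<psi> x = 0} \<and>
     (\<forall>x\<in>U \<inter> M. rank (jacobian \<psi> (at x)) = CARD('p))"

text \<open>The type argument fixes the codimension \<open>p = CARD('p)\<close>, so the dimension is \<open>d - p\<close>.\<close>

definition embedded_submanifold :: "'p::finite itself \<Rightarrow> (real^'d) set \<Rightarrow> bool" where
  "embedded_submanifold _ M \<longleftrightarrow>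
     (\<forall>x\<in>M. \<exists>U (\<psi> :: real^'d \<Rightarrow> real^'p). x \<in> U \<and> local_defining_function M U \<psi>)"

definition tangent_space :: "'a::euclidean_space set \<Rightarrow> 'a \<Rightarrow> 'a set" where
  "tangent_space M x =
     {v. \<exists>\<epsilon>>0. \<exists>c :: real \<Rightarrow> 'a. smooth_on {-\<epsilon><..<\<epsilon>} c \<and> (\<forall>t\<in>{-\<epsilon><..<\<epsilon>}. c t \<in> M) \<and>
          c 0 = x \<and> (c has_vector_derivative v) (at 0)}"

definition tangent_bundle :: "'a::euclidean_space set \<Rightarrow> ('a \<times> 'a) set" where
  "tangent_bundle M = {(x, \<eta>). x \<in> M \<and> \<eta> \<in> tangent_space M x}"

definition tangent_proj :: "'a::euclidean_space set \<Rightarrow> 'a \<Rightarrow> 'a \<Rightarrow> 'a" where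
  "tangent_proj M x v = closest_point (tangent_space M x) v"

definition rgrad :: "'a::euclidean_space set \<Rightarrow> ('a \<Rightarrow> real) \<Rightarrow> 'a \<Rightarrow> 'a" where
  "rgrad M h x = tangent_proj M x (gradient h x)"

definition retraction_on :: "'a::euclidean_space set \<Rightarrow> ('a \<Rightarrow> 'a \<Rightarrow> 'a) \<Rightarrow> bool" where
  "retraction_on M Retr \<longleftrightarrow>
     smooth_map_on (tangent_bundle M) (\<lambda>(x, \<eta>). Retr x \<eta>) \<and>
     (\<forall>x\<in>M. (\<forall>\<eta>\<in>tangent_space M x. Retr x \<eta> \<in> M) \<and> Retr x 0 = x \<and>
        (Retr x has_derivative (\<lambda>\<eta>. \<eta>)) (at 0 within tangent_space M x))"

text \<open>
  The supremum is taken in the reals; it is only used for the strongly convex functions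
  \<open>model_fun\<close>, for which it is finite at every point.
\<close>

definition fenchel_conjugate :: "('a::euclidean_space \<Rightarrow> real) \<Rightarrow> 'a \<Rightarrow> real" where
  "fenchel_conjugate h y = (SUP \<eta>. y \<bullet> \<eta> - h \<eta>)"

definition prox :: "('a::euclidean_space \<Rightarrow> real) \<Rightarrow> 'a \<Rightarrow> 'a" where
  "prox h z = (ARG_MIN (\<lambda>y. h y + (norm (y - z))\<^sup>2 / 2) y. True)"

definition model_fun ::
    "real \<Rightarrow> ('a::euclidean_space \<Rightarrow> real) \<Rightarrow> 'a \<Rightarrow> 'a \<Rightarrow> 'a \<Rightarrow> real" where
  "model_fun \<alpha> R x m \<eta> = m \<bullet> \<eta> + (norm \<eta>)\<^sup>2 / (2 * \<alpha>) + R (x + \<eta>)"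

definition dual_fun ::
    "real \<Rightarrow> (real^'d \<Rightarrow> real) \<Rightarrow> real^'d^'p \<Rightarrow> real^'d \<Rightarrow> real^'d \<Rightarrow> real^'p \<Rightarrow> real" where
  "dual_fun \<alpha> R B x m l = fenchel_conjugate (model_fun \<alpha> R x m) (- (transpose B *v l))"

definition C_alpha :: "real \<Rightarrow> real \<Rightarrow> real \<Rightarrow> real \<Rightarrow> real \<Rightarrow> real \<Rightarrow> real" where
  "C_alpha l\<^sub>R C\<^sub>0 \<Delta>bar M\<^sub>u \<delta> \<delta>\<^sub>T =
     ((sqrt (l\<^sub>R * C\<^sub>0 * \<Delta>bar + (M\<^sub>u + l\<^sub>R) * min \<delta> \<delta>\<^sub>T) - sqrt (l\<^sub>R * C\<^sub>0 * \<Delta>bar))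
        / (M\<^sub>u + l\<^sub>R))\<^sup>2"

definition preimages :: "'o measure \<Rightarrow> 'b measure \<Rightarrow> ('o \<Rightarrow> 'b) \<Rightarrow> 'o set set" where
  "preimages P N X = {X -` A \<inter> space P | A. A \<in> sets N}"

text \<open>
  \<open>history P N x mbar S batch u lam w eta k\<close> is the \<open>\<sigma>\<close>-algebra generated by everything produced
  before the \<open>k\<close>-th batch is sampled.  \<open>S j\<close> (with values in the measurable space \<open>N\<close>) is the
  estimator state on entering iteration \<open>j\<close>; no batch is sampled in iteration 0.  The clipped
  estimator and the momentum of earlier iterations are functions of the listed quantities, and the
  parameters are required to be measurable with respect to this \<open>\<sigma>\<close>-algebra.
\<close>

definition history ::
    "'o measure \<Rightarrow> 's measure \<Rightarrow> (nat \<Rightarrow> 'o \<Rightarrow> real^'d) \<Rightarrow> (nat \<Rightarrow> 'o \<Rightarrow> real^'d) \<Rightarrow>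
     (nat \<Rightarrow> 'o \<Rightarrow> 's) \<Rightarrow> (nat \<Rightarrow> 'o \<Rightarrow> nat multiset) \<Rightarrow> (nat \<Rightarrow> 'o \<Rightarrow> real^'d) \<Rightarrow>
     (nat \<Rightarrow> 'o \<Rightarrow> real^'p) \<Rightarrow> (nat \<Rightarrow> 'o \<Rightarrow> real^'d) \<Rightarrow> (nat \<Rightarrow> 'o \<Rightarrow> real^'d) \<Rightarrow>
     nat \<Rightarrow> 'o measure" where
  "history P N x mbar S batch u lam w eta k =
     sigma (space P)
       ((\<Union>j\<in>{..k}. preimages P borel (x j) \<union> preimages P borel (mbar j) \<union> preimages P N (S j)) \<union>
        (\<Union>j\<in>{1..<k}. preimages P (count_space UNIV) (batch j)) \<union>
        (\<Union>j\<in>{..<k}. preimages P borel (u j) \<union> preimages P borel (lam j) \<union>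
                      preimages P borel (w j) \<union> preimages P borel (eta j)))"

text \<open>
  In the inequality \<open>\<E> (Suc k)\<close> is not assumed to be integrable, so its conditional expectation is
  a priori \<open>[0, \<infinity>]\<close>-valued; the inequality makes sense only if it is finite.  This is recorded
  separately because \<^const>\<open>real_cond_exp\<close> sends the value \<open>\<infinity>\<close> to 0.
\<close>

definition error_dissipation ::
    "'o measure \<Rightarrow> (nat \<Rightarrow> 'o measure) \<Rightarrow> (nat \<Rightarrow> 'o \<Rightarrow> 'a::euclidean_space) \<Rightarrow>
     (nat \<Rightarrow> 'o \<Rightarrow> 'a) \<Rightarrow> (nat \<Rightarrow> 'o \<Rightarrow> real) \<Rightarrow> real \<Rightarrow> real \<Rightarrow> real \<Rightarrow> bool" where
  "error_dissipation P Fil e \<eta> \<E> c\<^sub>e \<mu> \<nu> \<longleftrightarrow>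
     c\<^sub>e > 0 \<and> \<mu> > 0 \<and> \<nu> > 0 \<and>
     (\<forall>k. \<E> k \<in> borel_measurable (Fil k)) \<and>
     (\<forall>k. \<forall>\<omega>\<in>space P. \<E> k \<omega> \<ge> 0) \<and>
     integrable P (\<E> 0) \<and>
     (\<forall>k. AE \<omega> in P.
        nn_cond_exp P (Fil k) (\<lambda>\<omega>. ennreal (\<E> (Suc k) \<omega>)) \<omega> < \<infinity> \<and>
        real_cond_exp P (Fil k) (\<lambda>\<omega>. (norm (e k \<omega>))\<^sup>2) \<omega> + \<mu> * \<E> k \<omega>
          \<le> c\<^sub>e * (\<E> k \<omega> - real_cond_exp P (Fil k) (\<E> (Suc k)) \<omega>)
            + \<nu> * real_cond_exp P (Fil k) (\<lambda>\<omega>. (norm (\<eta> k \<omega>))\<^sup>2) \<omega>)"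

end

theory Submission
  imports Defs
begin

text \<open>
  Along every path the exact tangent step satisfies
  \<open>F\<^sub>k (\<eta>hat) + norm \<eta>hat ^ 2 / (2 \<alpha>) \<le> F\<^sub>k 0\<close> by strong convexity. The dual residual is
  \<open>\<nabla>G\<^sub>k \<lambda> = - B w\<close>, so \<open>w\<close> lies within \<open>C\<^sub>0 \<Delta>\<^sub>k\<close> of the tangent space, and since \<open>w\<close>
  minimises \<open>F\<^sub>k + \<langle>B\<^sup>T \<lambda>, \<cdot>\<rangle>\<close>, projecting it costs at most
  \<open>F\<^sub>k \<eta> \<le> F\<^sub>k (\<eta>hat) + 2 l\<^sub>R C\<^sub>0 \<Delta>\<^sub>k\<close>. The bound on \<open>\<alpha>\<close> by \<^const>\<open>C_alpha\<close> keeps \<open>\<eta>\<close> in the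
  region where the retraction estimates apply, which together with Young's inequality for
  \<open>\<langle>e, \<eta>\<rangle>\<close> gives the pathwise descent. Conditional expectations and the error-dissipation
  condition, scaled by \<open>1 / (2 \<tau>)\<close>, then yield the claim. Taking conditional expectations needs
  the measurability of the tangential gradient, which comes from semicontinuity of the distance
  to the tangent spaces.
\<close>

subsection \<open>Tangent spaces\<close>

text \<open>Tangent vectors are velocities of smooth curves in \<open>M\<close>, so
  \<open>tangent_space M x\<close> is not visibly a subspace, while orthogonal projection onto it
  requires one. The chain rule places it inside the kernel of \<open>B x\<close>. The converse,
  usually drawn from the implicit function theorem, comes here from the error bound with
  \<open>C\<^sub>0\<close>: a kernel vector has distance 0 from the tangent space. It remains to see
  that the tangent space is closed, and this is where smoothness of the retraction enters.
  Compactness of \<open>M\<close> and clipping at \<open>M\<^sub>u\<close> bound every random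
  quantity of an iteration, so all terms that are averaged are bounded functions. The damping
  \<open>gam k\<close> survives only in front of the two step terms; in front of the error and of
  the inexactness it is estimated by 1.\<close>

lemma Ck_on_subset: "Ck_on k S f \<Longrightarrow> T \<subseteq> S \<Longrightarrow> Ck_on k T f"
  by (induction k arbitrary: f) (auto intro: continuous_on_subset)

lemma Ck_on_const: "Ck_on k S (\<lambda>_. c)"
proof (induction k arbitrary: c)
  case (Suc k)
  have "frechet_derivative (\<lambda>_. c) (at x) = (\<lambda>_. 0)" for x :: 'a
    by (metis frechet_derivative_at has_derivative_const)
  then show ?case using Suc by simp
qed simp

text \<open>Derivatives at a point of an open set depend only on the values inside the set, so the
  equality passes to all directional derivatives and the induction goes on with these.\<close>

lemma Ck_on_cong:
  assumes "open S" "\<And>x. x \<in> S \<Longrightarrow> f x = g x" "Ck_on k S f"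
  shows "Ck_on k S g"
  using assms(2,3)
proof (induction k arbitrary: f g)
  case 0
  then show ?case by (auto cong: continuous_on_cong)
next
  case (Suc k)
  have der: "(g has_derivative frechet_derivative f (at x)) (at x)" if "x \<in> S" for x
  proof (rule has_derivative_transform_within_open[of f])
    show "(f has_derivative frechet_derivative f (at x)) (at x)"
      using Suc.prems(2) that frechet_derivative_works by auto
  qed (use Suc.prems(1) that assms(1) in auto)
  then have "frechet_derivative f (at x) = frechet_derivative g (at x)" if "x \<in> S" for x
    using that frechet_derivative_at by blast
  then have "Ck_on k S (\<lambda>x. frechet_derivative g (at x) v)" for v
    using Suc.IH[of "\<lambda>x. frechet_derivative f (at x) v" "\<lambda>x. frechet_derivative g (at x) v"]
      Suc.prems by simp
  then show ?case using der by (auto simp: differentiable_def)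
qed

text \<open>The derivative of the composite along \<open>v\<close> is the derivative of
  \<open>g\<close> along the fixed vector \<open>L v\<close>, composed with the same affine map. The
  induction therefore closes without a product rule. The lemma serves reparametrised curves and rays
  fed into a smooth extension of the retraction.\<close>

lemma Ck_on_compose_affine:
  assumes "open S" "bounded_linear L" "Ck_on k S g"
  shows "Ck_on k ((\<lambda>t. a + L t) -` S) (\<lambda>t. g (a + L t))"
  using assms(3)
proof (induction k arbitrary: g)
  case 0
  have "continuous_on T (\<lambda>t. a + L t)" for T
    using linear_continuous_on[OF assms(2)] by (intro continuous_intros)
  then show ?case using 0 by (auto intro: continuous_on_compose2[of S])
next
  case (Suc k)
  let ?T = "(\<lambda>t. a + L t) -` S"
  have T: "open ?T"
    using assms(1) linear_continuous_on[OF assms(2)] by (intro open_vimage continuous_intros)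
  have der: "((\<lambda>t. g (a + L t)) has_derivative (\<lambda>v. frechet_derivative g (at (a + L t)) (L v))) (at t)"
    if "t \<in> ?T" for t
  proof -
    have "((\<lambda>t. a + L t) has_derivative L) (at t)"
      using has_derivative_add[OF has_derivative_const bounded_linear_imp_has_derivative[OF assms(2)]]
      by simp
    moreover have "(g has_derivative frechet_derivative g (at (a + L t))) (at (a + L t))"
      using Suc.prems that frechet_derivative_works by auto
    ultimately show ?thesis by (rule has_derivative_compose)
  qed
  have "Ck_on k ?T (\<lambda>t. frechet_derivative (\<lambda>t. g (a + L t)) (at t) v)" for v
  proof (rule Ck_on_cong[OF T])
    show "Ck_on k ?T (\<lambda>t. frechet_derivative g (at (a + L t)) (L v))"
      using Suc.IH[of "\<lambda>x. frechet_derivative g (at x) (L v)"] Suc.prems by simp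
  qed (use der frechet_derivative_at in metis)
  then show ?case using der by (auto simp: differentiable_def)
qed

lemma zero_in_tangent_space: "x \<in> M \<Longrightarrow> 0 \<in> tangent_space M x"
  unfolding tangent_space_def smooth_on_def
  by (auto intro!: exI[of _ 1] exI[of _ "\<lambda>_. x"] Ck_on_const)

text \<open>Scaling a tangent vector reparametrises its curve. This much of the subspace structure
  is already needed to prove closedness, which works along rays.\<close>

lemma tangent_space_scaleR:
  assumes "v \<in> tangent_space M x"
  shows "s *\<^sub>R v \<in> tangent_space M x"
proof -
  from assms obtain e c where e: "e > 0" and c: "smooth_on {-e<..<e} c" "\<And>t. t \<in> {-e<..<e} \<Longrightarrow> c t \<in> M"
    "c 0 = x" "(c has_vector_derivative v) (at 0)"
    unfolding tangent_space_def by blast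
  \<comment> \<open>The summand 1 keeps \<open>d\<close> well defined for \<open>s = 0\<close> and
    makes the bound on \<open>s * t\<close> strict.\<close>
  define d where "d = e / (\<bar>s\<bar> + 1)"
  have d: "d > 0" using e by (simp add: d_def)
  have sub: "s * t \<in> {-e<..<e}" if "t \<in> {-d<..<d}" for t
  proof -
    have "\<bar>s * t\<bar> \<le> \<bar>s\<bar> * d" using that by (auto simp: abs_mult intro!: mult_left_mono)
    also have "\<dots> < (\<bar>s\<bar> + 1) * d" using d by simp
    also have "\<dots> = e" by (simp add: d_def)
    finally show ?thesis by auto
  qed
  have "Ck_on k ((\<lambda>t. 0 + s * t) -` {-e<..<e}) (\<lambda>t. c (0 + s * t))" for k
    using c(1) by (intro Ck_on_compose_affine) (auto simp: smooth_on_def bounded_linear_mult_right)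
  moreover have "{-d<..<d} \<subseteq> (\<lambda>t. 0 + s * t) -` {-e<..<e}"
    using sub by (auto simp del: greaterThanLessThan_iff)
  ultimately have "Ck_on k {-d<..<d} (\<lambda>t. c (0 + s * t))" for k
    using Ck_on_subset by blast
  then have "smooth_on {-d<..<d} (\<lambda>t. c (s * t))"
    by (simp add: smooth_on_def)
  moreover have "((\<lambda>t. c (s * t)) has_vector_derivative s *\<^sub>R v) (at 0)"
  proof -
    have "((\<lambda>t. s * t) has_real_derivative s) (at 0)"
      by (auto intro!: derivative_eq_intros)
    then show ?thesis
      using vector_diff_chain_at[of "\<lambda>t. s * t" s 0 c v] c(4)
      by (simp add: has_real_derivative_iff_has_vector_derivative o_def)
  qed
  ultimately show ?thesis
    unfolding tangent_space_def using d sub c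
    by (auto intro!: exI[of _ d] exI[of _ "\<lambda>t. c (s * t)"])
qed

text \<open>A smooth extension of the retraction around \<open>(x, 0)\<close> maps limits of tangent vectors into
  the closed set \<open>M\<close>, so its rays provide the curves that realise these limits.\<close>

lemma closed_tangent_space:
  assumes retr: "retraction_on M Retr" and M: "closed M" and x: "x \<in> M"
  shows "closed (tangent_space M x)"
proof -
  let ?T = "tangent_space M x"
  have "(x, 0) \<in> tangent_bundle M"
    using x by (simp add: tangent_bundle_def zero_in_tangent_space)
  \<comment> \<open>Unlike \<open>Retr\<close>, the extension \<open>g\<close> has known behaviour
    at \<open>(x, t *\<^sub>R v)\<close> before \<open>v\<close> is known to be tangent.\<close>
  then obtain W g where W: "(x, 0) \<in> W" "smooth_on W g"
    and g: "\<And>z. z \<in> W \<inter> tangent_bundle M \<Longrightarrow> g z = Retr (fst z) (snd z)"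
    using retr unfolding retraction_on_def smooth_map_on_def by (fastforce simp: case_prod_beta)
  have oW: "open W" and Wk: "Ck_on k W g" for k using W(2) by (auto simp: smooth_on_def)
  have cg: "continuous_on W g" using Wk[of 0] by simp
  have RM: "Retr x u \<in> M" if "u \<in> ?T" for u using retr x that by (auto simp: retraction_on_def)
  have Rd: "(Retr x has_derivative (\<lambda>u. u)) (at 0 within ?T)" and R0: "Retr x 0 = x"
    using retr x by (auto simp: retraction_on_def)
  define D where "D = frechet_derivative g (at (x, 0))"
  have gD: "(g has_derivative D) (at (x, 0))"
    unfolding D_def using Wk[of "Suc 0"] W(1) by (simp add: frechet_derivative_works)
  have ray: "((\<lambda>t. g ((x, 0) + (0, t *\<^sub>R u))) has_vector_derivative D (0, u)) (at 0)" for u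
  proof -
    have 1: "((\<lambda>t. (x, 0) + (0, t *\<^sub>R u)) has_derivative (\<lambda>t. (0, t *\<^sub>R u))) (at 0)"
      by (auto intro!: derivative_eq_intros)
    have "(g has_derivative D) (at ((x, 0) + (0, 0 *\<^sub>R u)))" using gD by simp
    from has_derivative_compose[OF 1 this]
    have "((\<lambda>t. g ((x, 0) + (0, t *\<^sub>R u))) has_derivative (\<lambda>t. D (0, t *\<^sub>R u))) (at 0)" .
    moreover have "D (0, t *\<^sub>R u) = t *\<^sub>R D (0, u)" for t
      using linear_scale[OF has_derivative_linear[OF gD], of t "(0, u)"] by simp
    ultimately show ?thesis by (simp add: has_vector_derivative_def)
  qed
  have openray: "open ((\<lambda>t. (x, 0) + (0, t *\<^sub>R u)) -` W)" for u :: 'a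
    by (intro open_vimage oW continuous_intros)
  \<comment> \<open>For tangent \<open>u\<close> the whole ray is tangent, so \<open>g\<close>
    agrees with \<open>Retr x\<close> along it, and the derivative of \<open>Retr x\<close> at 0
    within the tangent space is the identity.\<close>
  have DT: "D (0, u) = u" if u: "u \<in> ?T" for u
  proof -
    have 1: "((\<lambda>t. t *\<^sub>R u) has_derivative (\<lambda>t. t *\<^sub>R u)) (at 0)"
      by (auto intro!: derivative_eq_intros)
    have 2: "(Retr x has_derivative (\<lambda>u. u)) (at (0 *\<^sub>R u) within range (\<lambda>t. t *\<^sub>R u))"
      using Rd u by (auto intro: has_derivative_subset tangent_space_scaleR)
    have "((\<lambda>t. Retr x (t *\<^sub>R u)) has_derivative (\<lambda>t. t *\<^sub>R u)) (at 0)"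
      using diff_chain_within[OF 1 2] by (simp add: o_def)
    then have "((\<lambda>t. g ((x, 0) + (0, t *\<^sub>R u))) has_derivative (\<lambda>t. t *\<^sub>R u)) (at 0)"
    proof (rule has_derivative_transform_within_open[OF _ openray[of u]])
      show "0 \<in> (\<lambda>t. (x, 0) + (0, t *\<^sub>R u)) -` W" using W(1) by simp
      show "Retr x (t *\<^sub>R u) = g ((x, 0) + (0, t *\<^sub>R u))"
        if "t \<in> (\<lambda>t. (x, 0) + (0, t *\<^sub>R u)) -` W" for t
        using g[of "(x, t *\<^sub>R u)"] that u x by (simp add: tangent_bundle_def tangent_space_scaleR)
    qed
    then have "((\<lambda>t. g ((x, 0) + (0, t *\<^sub>R u))) has_vector_derivative u) (at 0)"
      by (simp add: has_vector_derivative_def)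
    then show ?thesis using ray vector_derivative_unique_at by blast
  qed
  show ?thesis unfolding closed_sequential_limits
  proof (intro allI impI, elim conjE)
    fix s v assume s: "\<forall>n. s n \<in> ?T" and lim: "s \<longlonglongrightarrow> v"
    have "D (0, v) = v"
    proof (rule LIMSEQ_unique[of "\<lambda>n. D (0, s n)"])
      show "(\<lambda>n. D (0, s n)) \<longlonglongrightarrow> D (0, v)"
        by (rule bounded_linear.tendsto[OF has_derivative_bounded_linear[OF gD]]) (intro tendsto_intros lim)
      show "(\<lambda>n. D (0, s n)) \<longlonglongrightarrow> v" using s lim DT by simp
    qed
    then have der: "((\<lambda>t. g ((x, 0) + (0, t *\<^sub>R v))) has_vector_derivative v) (at 0)" using ray by metis
    have "0 \<in> (\<lambda>t. (x, 0) + (0, t *\<^sub>R v)) -` W" using W(1) by simp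
    then obtain e where e: "e > 0" "ball 0 e \<subseteq> (\<lambda>t. (x, 0) + (0, t *\<^sub>R v)) -` W"
      using openE[OF openray] by blast
    have eW: "(x, 0) + (0, t *\<^sub>R v) \<in> W" if "t \<in> {-e<..<e}" for t
      using e(2) that by (auto simp: subset_iff dist_real_def)
    have "Ck_on k ((\<lambda>t. (x, 0) + (0, t *\<^sub>R v)) -` W) (\<lambda>t. g ((x, 0) + (0, t *\<^sub>R v)))" for k
      by (intro Ck_on_compose_affine oW Wk bounded_linear_Pair bounded_linear_zero
          bounded_linear_scaleR_left)
    moreover have "{-e<..<e} \<subseteq> (\<lambda>t. (x, 0) + (0, t *\<^sub>R v)) -` W" using eW by blast
    ultimately have "Ck_on k {-e<..<e} (\<lambda>t. g ((x, 0) + (0, t *\<^sub>R v)))" for k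
      using Ck_on_subset by blast
    then have sm: "smooth_on {-e<..<e} (\<lambda>t. g ((x, 0) + (0, t *\<^sub>R v)))"
      by (simp add: smooth_on_def)
    have inM: "g ((x, 0) + (0, t *\<^sub>R v)) \<in> M" if t: "t \<in> {-e<..<e}" for t
    proof -
      have l: "(\<lambda>n. (x, 0) + (0, t *\<^sub>R s n)) \<longlonglongrightarrow> (x, 0) + (0, t *\<^sub>R v)"
        by (intro tendsto_intros lim)
      have ev: "\<forall>\<^sub>F n in sequentially. (x, 0) + (0, t *\<^sub>R s n) \<in> W"
        using topological_tendstoD[OF l oW eW[OF t]] .
      have "isCont g ((x, 0) + (0, t *\<^sub>R v))"
        using cg oW eW[OF t] continuous_on_eq_continuous_at by blast
      then have "(\<lambda>n. g ((x, 0) + (0, t *\<^sub>R s n))) \<longlonglongrightarrow> g ((x, 0) + (0, t *\<^sub>R v))"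
        using l isCont_tendsto_compose by blast
      moreover have "\<forall>\<^sub>F n in sequentially. g ((x, 0) + (0, t *\<^sub>R s n)) \<in> M"
        using ev
      proof eventually_elim
        case (elim n)
        then show ?case using g[of "(x, t *\<^sub>R s n)"] s x RM
          by (simp add: tangent_bundle_def tangent_space_scaleR)
      qed
      ultimately show ?thesis using M Lim_in_closed_set by (metis sequentially_bot)
    qed
    have "g ((x, 0) + (0, 0 *\<^sub>R v)) = x"
      using g[of "(x, 0)"] W(1) x R0 by (simp add: tangent_bundle_def zero_in_tangent_space)
    then show "v \<in> ?T"
      unfolding tangent_space_def using e(1) sm inM der
      by (intro CollectI exI[of _ e] conjI exI[of _ "\<lambda>t. g ((x, 0) + (0, t *\<^sub>R v))"] ballI) auto
  qed
qed

section \<open>Derivatives of the defining functions\<close>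

lemma jacobian_mult_vec:
  fixes f :: "real^'a \<Rightarrow> real^'b"
  assumes "f differentiable (at y)"
  shows "jacobian f (at y) *v v = frechet_derivative f (at y) v"
proof -
  have "(f has_derivative (\<lambda>h. jacobian f (at y) *v h)) (at y)"
    using assms jacobian_works by blast
  then show ?thesis using frechet_derivative_at by metis
qed

lemma local_defining_function_differentiable:
  assumes "local_defining_function M W \<psi>" "y \<in> W"
  shows "\<psi> differentiable (at y)"
  using assms unfolding local_defining_function_def smooth_on_def
  by (auto dest: spec[of _ "Suc 0"])

text \<open>The defining function vanishes along a curve in \<open>M\<close>, so the chain rule
  annihilates the velocity. Any chart around \<open>y\<close> is allowed, not only the selected one;
  semicontinuity of the distance uses this for all charts at once.\<close>

lemma tangent_space_jacobian:
  assumes ldf: "local_defining_function M W \<psi>" and y: "y \<in> W" and v: "v \<in> tangent_space M y"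
  shows "jacobian \<psi> (at y) *v v = 0"
proof -
  from v obtain e c where e: "e > 0" and c: "\<And>t. t \<in> {-e<..<e} \<Longrightarrow> c t \<in> M"
    "c 0 = y" "(c has_vector_derivative v) (at 0)"
    unfolding tangent_space_def by blast
  have oW: "open W" and zero: "\<And>z. z \<in> W \<Longrightarrow> z \<in> M \<Longrightarrow> \<psi> z = 0"
    using ldf unfolding local_defining_function_def smooth_on_def by auto
  have df: "\<psi> differentiable (at y)" using local_defining_function_differentiable ldf y .
  let ?D = "frechet_derivative \<psi> (at y)"
  have D: "(\<psi> has_derivative ?D) (at (c 0))" using df c(2) frechet_derivative_works by blast
  have c': "(c has_derivative (\<lambda>t. t *\<^sub>R v)) (at 0)" using c(3) by (simp add: has_vector_derivative_def)
  have 1: "((\<lambda>t. \<psi> (c t)) has_derivative (\<lambda>t. ?D (t *\<^sub>R v))) (at 0)"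
    using has_derivative_compose[OF c' D] .
  have "(c \<longlongrightarrow> c 0) (nhds 0)"
    using has_derivative_continuous[OF c'] by (simp add: continuous_at tendsto_nhds_iff isCont_def)
  then have "\<forall>\<^sub>F t in nhds 0. c t \<in> W"
    using c(2) y oW by (auto dest: topological_tendstoD)
  moreover have "\<forall>\<^sub>F t in nhds 0. t \<in> {-e<..<e}"
    using e by (intro eventually_nhds_in_open) auto
  ultimately have "\<forall>\<^sub>F t in nhds 0. \<psi> (c t) = 0"
    by eventually_elim (use c zero in blast)
  then obtain Z where Z: "open Z" "0 \<in> Z" "\<And>t. t \<in> Z \<Longrightarrow> \<psi> (c t) = 0"
    unfolding eventually_nhds by blast
  have "((\<lambda>t. \<psi> (c t)) has_derivative (\<lambda>_. 0)) (at 0)"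
    by (rule has_derivative_transform_within_open[OF _ Z(1,2), of "\<lambda>_. 0"]) (auto simp: Z(3))
  from has_derivative_unique[OF 1 this] have "?D (1 *\<^sub>R v) = 0" by metis
  then show ?thesis using jacobian_mult_vec[OF df] by simp
qed

subsection \<open>The strongly convex model\<close>

lemma closest_point_in_subspace:
  fixes T :: "'a::euclidean_space set"
  assumes "subspace T"
  shows "closest_point T v \<in> T"
  using assms closed_subspace subspace_0 closest_point_in_set by blast

lemma closest_point_subspace_orthogonal:
  fixes T :: "'a::euclidean_space set"
  assumes T: "subspace T" and t: "t \<in> T"
  shows "(v - closest_point T v) \<bullet> t = 0"
proof -
  note dot = closest_point_dot[OF subspace_imp_convex[OF T] closed_subspace[OF T], of _ v]
  note p = closest_point_in_subspace[OF T, of v]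
  show ?thesis
    using dot[OF subspace_add[OF T p t]] dot[OF subspace_diff[OF T p t]] by simp
qed

lemma closest_point_subspace_eqI:
  fixes T :: "'a::euclidean_space set"
  assumes "subspace T" "p \<in> T" "\<And>t. t \<in> T \<Longrightarrow> (v - p) \<bullet> t = 0"
  shows "closest_point T v = p"
proof -
  note cp = closest_point_in_subspace[OF assms(1), of v]
    closest_point_subspace_orthogonal[OF assms(1), of _ v]
  let ?d = "closest_point T v - p"
  have d: "?d \<in> T" using subspace_diff assms(1,2) cp(1) by blast
  have "?d \<bullet> ?d = (v - p) \<bullet> ?d - (v - closest_point T v) \<bullet> ?d" by (simp add: inner_diff_left)
  also have "\<dots> = 0" using assms(3)[OF d] cp(2)[OF d] by simp
  finally show ?thesis by simp
qed

lemma closest_point_subspace_add: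
  fixes T :: "'a::euclidean_space set"
  assumes T: "subspace T"
  shows "closest_point T (u + v) = closest_point T u + closest_point T v"
proof (rule closest_point_subspace_eqI[OF T])
  show "closest_point T u + closest_point T v \<in> T"
    by (intro subspace_add[OF T] closest_point_in_subspace[OF T])
  show "(u + v - (closest_point T u + closest_point T v)) \<bullet> t = 0" if "t \<in> T" for t
    using closest_point_subspace_orthogonal[OF T that, of u]
      closest_point_subspace_orthogonal[OF T that, of v]
    by (simp add: inner_diff_left inner_add_left)
qed

lemma closest_point_subspace_diff:
  fixes T :: "'a::euclidean_space set"
  assumes T: "subspace T"
  shows "closest_point T (u - v) = closest_point T u - closest_point T v"
  using closest_point_subspace_add[OF T, of "u - v" v] by simp

lemma closest_point_subspace_self_adjoint:
  fixes T :: "'a::euclidean_space set"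
  assumes T: "subspace T"
  shows "closest_point T u \<bullet> v = u \<bullet> closest_point T v"
    and "closest_point T u \<bullet> v = closest_point T u \<bullet> closest_point T v"
proof -
  have *: "closest_point T u \<bullet> v = closest_point T u \<bullet> closest_point T v" for u v
    using closest_point_subspace_orthogonal[OF T closest_point_in_subspace[OF T], of v u]
    by (simp add: inner_diff_left inner_diff_right inner_commute)
  then show "closest_point T u \<bullet> v = closest_point T u \<bullet> closest_point T v" .
  show "closest_point T u \<bullet> v = u \<bullet> closest_point T v"
    using *[of u v] *[of v u] by (simp add: inner_commute)
qed

lemma closest_point_subspace_pythagoras:
  fixes T :: "'a::euclidean_space set"
  assumes "subspace T"
  shows "(norm v)\<^sup>2 = (norm (closest_point T v))\<^sup>2 + (infdist v T)\<^sup>2"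
    and "infdist v T = norm (v - closest_point T v)"
proof -
  have T: "closed T" "T \<noteq> {}" using assms closed_subspace subspace_0 by auto
  show 1: "infdist v T = norm (v - closest_point T v)"
    using T setdist_closest_point[OF T, of v] by (simp add: infdist_eq_setdist dist_norm)
  have "v \<bullet> v = (closest_point T v) \<bullet> (closest_point T v)
      + (v - closest_point T v) \<bullet> (v - closest_point T v)"
    using closest_point_subspace_orthogonal[OF assms closest_point_in_subspace[OF assms], of v v]
    by (simp add: algebra_simps inner_commute)
  then show "(norm v)\<^sup>2 = (norm (closest_point T v))\<^sup>2 + (infdist v T)\<^sup>2"
    by (simp add: 1 dot_square_norm)
qed

lemma norm_closest_point_subspace_le:
  fixes T :: "'a::euclidean_space set"
  assumes "subspace T"
  shows "norm (closest_point T v) \<le> norm v"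
  using closest_point_subspace_pythagoras(1)[OF assms, of v]
  by (metis le_add_same_cancel1 norm_ge_zero power2_le_imp_le zero_le_power2)

text \<open>Projecting the clipped point onto \<open>T\<close> keeps it in the ball and brings it no
  farther from \<open>v\<close>, so uniqueness of the nearest point makes it a fixed point of the
  projection. Hence clipping keeps an estimator tangent.\<close>

lemma closest_point_cball_in_subspace:
  fixes T :: "'a::euclidean_space set"
  assumes T: "subspace T" and "v \<in> T" and r: "r \<ge> 0"
  shows "closest_point (cball 0 r) v \<in> T"
proof -
  let ?c = "closest_point (cball 0 r) v" and ?P = "closest_point T"
  have cT: "closed T" "convex T" "T \<noteq> {}"
    using assms closed_subspace subspace_imp_convex subspace_0 by auto
  have c: "?c \<in> cball 0 r" using closest_point_in_set[of "cball 0 r" v] r by auto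
  have "?P ?c \<in> cball 0 r"
    using c norm_closest_point_subspace_le[OF T, of ?c] by auto
  moreover have "dist v (?P ?c) \<le> dist v ?c"
    using closest_point_lipschitz[OF cT(2,1,3), of v ?c] closest_point_self[OF \<open>v \<in> T\<close>] by simp
  then have "\<forall>z\<in>cball 0 r. dist v (?P ?c) \<le> dist v z"
    using closest_point_le[of "cball 0 r" _ v] by (meson closed_cball order_trans)
  ultimately have "?P ?c = ?c"
    by (intro closest_point_unique) auto
  then show ?thesis using closest_point_in_subspace[OF T] by metis
qed

section \<open>Gradients\<close>

lemma gradient_eq:
  assumes "GDERIV h x :> D"
  shows "gradient h x = D"
  unfolding gradient_def
proof (rule the_equality[where P="\<lambda>D. GDERIV h x :> D", OF assms])
  fix D' assume "GDERIV h x :> D'"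
  then have "(\<lambda>v. v \<bullet> D') = (\<lambda>v. v \<bullet> D)"
    using assms unfolding gderiv_def by (rule has_derivative_unique)
  then have "(D' - D) \<bullet> (D' - D) = 0" by (metis inner_diff_right right_minus_eq)
  then show "D' = D" by simp
qed

text \<open>A quadratic error on both sides already forces differentiability. Comparison of optimal
  values yields exactly such a bound for the dual function.\<close>

lemma GDERIV_sandwich:
  fixes f :: "'a::euclidean_space \<Rightarrow> real"
  assumes "\<And>y. \<bar>f y - f x - (y - x) \<bullet> D\<bar> \<le> K * (norm (y - x))\<^sup>2"
  shows "GDERIV f x :> D"
  unfolding gderiv_def
proof (rule has_derivativeI_sandwich[of 1 _ _ _ _ "\<lambda>y. K * norm (y - x)"])
  show "((\<lambda>y. K * norm (y - x)) \<longlongrightarrow> 0) (at x)"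
    by (auto intro!: tendsto_eq_intros)
  show "norm (f y - f x - (y - x) \<bullet> D) / norm (y - x) \<le> K * norm (y - x)"
    if "y \<noteq> x" for y
    using assms[of y] that by (simp add: divide_le_eq power2_eq_square mult.assoc)
qed (auto intro: bounded_linear_inner_left)

lemma lipschitz_on_real_diff_le:
  fixes R :: "'a::real_normed_vector \<Rightarrow> real"
  assumes "l-lipschitz_on UNIV R"
  shows "R a - R b \<le> l * norm (a - b)"
  using lipschitz_onD[OF assms, of a b] by (auto simp: dist_norm)

section \<open>The model function, its minimisers and its dual\<close>

lemma model_fun_shift: "model_fun \<alpha> R x (m + b) y = model_fun \<alpha> R x m y + b \<bullet> y"
  by (simp add: model_fun_def inner_add_left)

lemma norm_convex_combination:
  fixes y z :: "'a::real_inner"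
  shows "(norm ((1 - t) *\<^sub>R z + t *\<^sub>R y))\<^sup>2
    = (1 - t) * (norm z)\<^sup>2 + t * (norm y)\<^sup>2 - t * (1 - t) * (norm (y - z))\<^sup>2"
  by (simp add: power2_norm_eq_inner algebra_simps inner_commute)

lemma model_fun_strongly_convex:
  assumes R: "convex_on UNIV R" and t: "0 \<le> t" "t \<le> 1"
  shows "model_fun \<alpha> R x m ((1 - t) *\<^sub>R z + t *\<^sub>R y)
    \<le> (1 - t) * model_fun \<alpha> R x m z + t * model_fun \<alpha> R x m y
      - t * (1 - t) * ((norm (y - z))\<^sup>2 / (2 * \<alpha>))"
proof -
  have "x + ((1 - t) *\<^sub>R z + t *\<^sub>R y) = (1 - t) *\<^sub>R (x + z) + t *\<^sub>R (x + y)"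
    by (simp add: algebra_simps)
  then have "R (x + ((1 - t) *\<^sub>R z + t *\<^sub>R y)) \<le> (1 - t) * R (x + z) + t * R (x + y)"
    using convex_onD[OF R t, of "x + z" "x + y"] by simp
  then show ?thesis
    unfolding model_fun_def norm_convex_combination
    by (simp add: algebra_simps diff_divide_distrib add_divide_distrib)
qed

text \<open>Compare \<open>z\<close> with the point a fraction \<open>t\<close> of the way towards
  \<open>y\<close>, divide by \<open>t\<close> and let \<open>t\<close> tend to 0. The limit is
  taken in the variable \<open>s = 1 - t\<close>, which tends to 1.\<close>

lemma model_fun_quadratic_growth:
  assumes R: "convex_on UNIV R" and S: "convex S" "z \<in> S" "y \<in> S"
    and min: "\<And>y. y \<in> S \<Longrightarrow> model_fun \<alpha> R x m z \<le> model_fun \<alpha> R x m y"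
  shows "model_fun \<alpha> R x m z + (norm (y - z))\<^sup>2 / (2 * \<alpha>) \<le> model_fun \<alpha> R x m y"
proof -
  have "s * ((norm (y - z))\<^sup>2 / (2 * \<alpha>)) \<le> model_fun \<alpha> R x m y - model_fun \<alpha> R x m z"
    if s: "0 < s" "s < 1" for s
  proof -
    let ?h = "model_fun \<alpha> R x m" and ?K = "(norm (y - z))\<^sup>2 / (2 * \<alpha>)"
    define t where "t = 1 - s"
    have t: "0 < t" "t < 1" "s = 1 - t" using s by (auto simp: t_def)
    have "(1 - t) *\<^sub>R z + t *\<^sub>R y \<in> S" using S t by (intro convexD_alt) auto
    then have "?h z \<le> (1 - t) * ?h z + t * ?h y - t * (1 - t) * ?K"
      using model_fun_strongly_convex[OF R, of t \<alpha> x m z y] t min by fastforce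
    moreover have "t * (s * ?K) = t * (1 - t) * ?K" using t(3) by simp
    ultimately have "t * (s * ?K) \<le> t * (?h y - ?h z)" by (simp only: algebra_simps)
    then show ?thesis using t(1) by (rule mult_left_le_imp_le)
  qed
  then have "(norm (y - z))\<^sup>2 / (2 * \<alpha>) \<le> model_fun \<alpha> R x m y - model_fun \<alpha> R x m z"
    by (rule field_le_mult_one_interval)
  then show ?thesis by simp
qed

lemma model_fun_attains_inf:
  fixes S :: "'a::euclidean_space set"
  assumes \<alpha>: "\<alpha> > 0" and R: "l-lipschitz_on UNIV R" and S: "closed S" "s \<in> S"
  shows "\<exists>z\<in>S. \<forall>y\<in>S. model_fun \<alpha> R x m z \<le> model_fun \<alpha> R x m y"
proof -
  let ?h = "model_fun \<alpha> R x m"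
  define K where "K = \<bar>?h s - R x\<bar> + 1"
  define c where "c = norm m + l"
  \<comment> \<open>The first entry keeps \<open>s\<close> in the ball. Beyond the second one,
    \<open>norm y\<close> is at least 1 and the quadratic term beats the linear slope
    \<open>c\<close> by \<open>K\<close>, so the model exceeds \<open>R x + K\<close>, which is
    larger than its value at \<open>s\<close>.\<close>
  define r where "r = max (norm s) (2 * \<alpha> * (c + K) + 1)"
  have l: "l \<ge> 0" using R lipschitz_on_nonneg by blast
  have c: "c \<ge> 0" "K > 0" using l by (auto simp: c_def K_def)
  have far: "?h s < ?h y" if y: "norm y > r" for y
  proof -
    have n: "norm y \<ge> 1" "norm y \<ge> 2 * \<alpha> * (c + K)" using y \<alpha> c
      by (auto simp: r_def intro: order_trans[of 1 "2 * \<alpha> * (c + K) + 1"])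
    have "m \<bullet> y \<ge> - (norm m * norm y)" using Cauchy_Schwarz_ineq2[of m y] by linarith
    moreover have "R (x + y) \<ge> R x - l * norm y"
      using lipschitz_on_real_diff_le[OF R, of x "x + y"] by simp
    ultimately have "?h y \<ge> R x + norm y * (norm y / (2 * \<alpha>) - c)"
      by (simp add: model_fun_def c_def algebra_simps power2_eq_square)
    moreover have "norm y / (2 * \<alpha>) - c \<ge> K"
      using n(2) \<alpha> by (simp add: field_simps)
    then have "norm y * (norm y / (2 * \<alpha>) - c) \<ge> 1 * K"
      using n(1) c by (intro mult_mono) auto
    ultimately show ?thesis by (simp add: K_def)
  qed
  have "continuous_on UNIV R" using R lipschitz_on_continuous_on by blast
  then have "continuous_on A (\<lambda>y. R (x + y))" for A
    by (rule continuous_on_compose2) (auto intro: continuous_intros)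
  then have cont: "continuous_on A ?h" for A
    unfolding model_fun_def using \<alpha> by (intro continuous_intros) auto
  have "compact (S \<inter> cball 0 r)" "S \<inter> cball 0 r \<noteq> {}"
    using S by (auto simp: r_def intro: compact_Int_closed closed_Int_compact)
  then obtain z where z: "z \<in> S \<inter> cball 0 r" "\<And>y. y \<in> S \<inter> cball 0 r \<Longrightarrow> ?h z \<le> ?h y"
    using continuous_attains_inf[OF _ _ cont] by meson
  have "?h z \<le> ?h y" if "y \<in> S" for y
  proof (cases "norm y \<le> r")
    case False
    have "?h z \<le> ?h s" using z(2)[of s] S by (auto simp: r_def)
    then show ?thesis using far[of y] False by simp
  qed (use z that in auto)
  then show ?thesis using z(1) by blast
qed

lemma arg_min_on_model_fun:
  fixes S :: "'a::euclidean_space set"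
  assumes \<alpha>: "\<alpha> > 0" and R: "l-lipschitz_on UNIV R" and S: "closed S" "s \<in> S"
  shows "arg_min_on (model_fun \<alpha> R x m) S \<in> S"
    and "y \<in> S \<Longrightarrow> model_fun \<alpha> R x m (arg_min_on (model_fun \<alpha> R x m) S) \<le> model_fun \<alpha> R x m y"
proof -
  let ?h = "model_fun \<alpha> R x m"
  obtain z where "z \<in> S" "\<forall>y\<in>S. ?h z \<le> ?h y"
    using model_fun_attains_inf[OF assms] by blast
  then have "is_arg_min ?h (\<lambda>x. x \<in> S) z" by (auto simp: is_arg_min_linorder)
  then have "is_arg_min ?h (\<lambda>x. x \<in> S) (arg_min_on ?h S)"
    unfolding arg_min_on_def arg_min_def by (rule someI)
  then show "arg_min_on ?h S \<in> S" "y \<in> S \<Longrightarrow> ?h (arg_min_on ?h S) \<le> ?h y"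
    by (auto simp: is_arg_min_linorder)
qed

text \<open>Completing the square turns the objective of the proximal map into \<alpha> times the
  model at \<open>y - x\<close> plus a constant, so both have the same minimisers.\<close>

lemma prox_minimizes_model_fun:
  fixes x :: "'a::euclidean_space"
  assumes \<alpha>: "\<alpha> > 0" and R: "l-lipschitz_on UNIV R"
  shows "model_fun \<alpha> R x m (prox (\<lambda>y. \<alpha> * R y) (x - \<alpha> *\<^sub>R m) - x) \<le> model_fun \<alpha> R x m y"
proof -
  let ?h = "model_fun \<alpha> R x m"
  define p where "p y = \<alpha> * R y + (norm (y - (x - \<alpha> *\<^sub>R m)))\<^sup>2 / 2" for y
  have p: "p y = \<alpha> * ?h (y - x) + \<alpha>\<^sup>2 * (norm m)\<^sup>2 / 2" for y
  proof -
    have "(norm ((y - x) + \<alpha> *\<^sub>R m))\<^sup>2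
        = (norm (y - x))\<^sup>2 + 2 * \<alpha> * (m \<bullet> (y - x)) + \<alpha>\<^sup>2 * (norm m)\<^sup>2"
      unfolding power2_norm_eq_inner
      by (simp only: inner_add_left inner_add_right inner_commute power2_eq_square inner_scaleR_left
          inner_scaleR_right)
    moreover have "y - (x - \<alpha> *\<^sub>R m) = (y - x) + \<alpha> *\<^sub>R m" by simp
    ultimately have "(norm (y - (x - \<alpha> *\<^sub>R m)))\<^sup>2
        = (norm (y - x))\<^sup>2 + 2 * \<alpha> * (m \<bullet> (y - x)) + \<alpha>\<^sup>2 * (norm m)\<^sup>2"
      by metis
    then show ?thesis using \<alpha> by (simp add: p_def model_fun_def field_simps)
  qed
  obtain z where "\<forall>y. ?h z \<le> ?h y"
    using model_fun_attains_inf[OF \<alpha> R closed_UNIV UNIV_I] by blast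
  then have "is_arg_min p (\<lambda>_. True) (x + z)"
    using \<alpha> by (simp add: is_arg_min_linorder p)
  then have "is_arg_min p (\<lambda>_. True) (prox (\<lambda>y. \<alpha> * R y) (x - \<alpha> *\<^sub>R m))"
    unfolding prox_def arg_min_def p_def[symmetric] by (rule someI)
  then have "p (prox (\<lambda>y. \<alpha> * R y) (x - \<alpha> *\<^sub>R m)) \<le> p (x + y)"
    by (simp add: is_arg_min_linorder)
  then show ?thesis using \<alpha> by (simp add: p)
qed

text \<open>The multiplier only shifts the linear term of the model; since the shifted model attains
  its minimum at \<open>w\<close>, the supremum in the conjugate is a maximum.\<close>

lemma dual_fun_eq:
  assumes "\<And>y. model_fun \<alpha> R x (m + transpose B *v l) w \<le> model_fun \<alpha> R x (m + transpose B *v l) y"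
  shows "dual_fun \<alpha> R B x m l = - model_fun \<alpha> R x (m + transpose B *v l) w"
proof -
  have "- (transpose B *v l) \<bullet> \<eta> - model_fun \<alpha> R x m \<eta>
      = - model_fun \<alpha> R x (m + transpose B *v l) \<eta>" for \<eta>
    by (simp add: model_fun_shift)
  then show ?thesis
    unfolding dual_fun_def fenchel_conjugate_def using assms
    by (auto intro!: cSup_eq_maximum)
qed

lemma inner_transpose_mult_vec:
  fixes B :: "real^'d^'p"
  shows "(transpose B *v l) \<bullet> v = l \<bullet> (B *v v)"
  by (simp add: dot_lmul_matrix)

text \<open>Envelope theorem: comparing the minimisers for two multipliers, strong convexity pins the
  change of the optimal value down up to a quadratic error.\<close>

lemma gradient_dual_fun:
  fixes B :: "real^'d^'p"
  assumes \<alpha>: "\<alpha> > 0" and Rc: "convex_on UNIV R" and Rl: "L-lipschitz_on UNIV R"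
    and w: "\<And>y. model_fun \<alpha> R x (m + transpose B *v l) w \<le> model_fun \<alpha> R x (m + transpose B *v l) y"
  shows "gradient (dual_fun \<alpha> R B x m) l = - (B *v w)"
proof (rule gradient_eq)
  obtain K where K: "\<And>v. norm (transpose B *v v) \<le> norm v * K"
    using bounded_linear.bounded[OF matrix_vector_mul_bounded_linear[of "transpose B"]] by blast
  show "GDERIV (dual_fun \<alpha> R B x m) l :> - (B *v w)"
  proof (rule GDERIV_sandwich)
    fix l'
    let ?b = "m + transpose B *v l" and ?b' = "m + transpose B *v l'"
    let ?h = "model_fun \<alpha> R x ?b" and ?h' = "model_fun \<alpha> R x ?b'"
    let ?D = "transpose B *v (l' - l)"
    obtain w' where w': "\<And>y. ?h' w' \<le> ?h' y"
      using model_fun_attains_inf[OF \<alpha> Rl closed_UNIV UNIV_I] by blast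
    have h': "?h' y = ?h y + ?D \<bullet> y" for y
    proof -
      have "?b' = ?b + ?D" by (simp add: matrix_vector_mult_diff_distrib)
      then show ?thesis using model_fun_shift by metis
    qed
    have le: "?h' w' \<le> ?h w + ?D \<bullet> w" using w'[of w] h' by simp
    have "?h w + (norm (w' - w))\<^sup>2 / (2 * \<alpha>) \<le> ?h w'"
      using model_fun_quadratic_growth[OF Rc convex_UNIV UNIV_I UNIV_I w] .
    moreover have "?D \<bullet> (w' - w) \<ge> - (norm ?D * norm (w' - w))"
      using Cauchy_Schwarz_ineq2[of ?D "w' - w"] by linarith
    ultimately have "?h' w' \<ge> ?h w + ?D \<bullet> w
        + ((norm (w' - w))\<^sup>2 / (2 * \<alpha>) - norm ?D * norm (w' - w))"
      using h'[of w'] by (simp add: inner_diff_right)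
    \<comment> \<open>Completing the square gives the worst case over all displacements of the
      minimiser.\<close>
    moreover have "(norm (w' - w))\<^sup>2 / (2 * \<alpha>) - norm ?D * norm (w' - w) \<ge> - (\<alpha> / 2 * (norm ?D)\<^sup>2)"
    proof -
      have "0 \<le> (norm (w' - w) - \<alpha> * norm ?D)\<^sup>2 / (2 * \<alpha>)" using \<alpha> by simp
      also have "\<dots> = (norm (w' - w))\<^sup>2 / (2 * \<alpha>) - norm ?D * norm (w' - w) + \<alpha> / 2 * (norm ?D)\<^sup>2"
        using \<alpha> by (simp add: power2_eq_square field_simps)
      finally show ?thesis by simp
    qed
    ultimately have ge: "?h' w' \<ge> ?h w + ?D \<bullet> w - \<alpha> / 2 * (norm ?D)\<^sup>2" by linarith
    have "?D \<bullet> w = - ((l' - l) \<bullet> - (B *v w))"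
      using inner_transpose_mult_vec[of B "l' - l" w] by simp
    then have "\<bar>dual_fun \<alpha> R B x m l' - dual_fun \<alpha> R B x m l - (l' - l) \<bullet> - (B *v w)\<bar>
        \<le> \<alpha> / 2 * (norm ?D)\<^sup>2"
      using le ge dual_fun_eq[OF w] dual_fun_eq[OF w'] by linarith
    also have "\<dots> \<le> \<alpha> / 2 * (norm (l' - l) * K)\<^sup>2"
      using K[of "l' - l"] \<alpha> by (intro mult_left_mono power_mono) auto
    finally show "\<bar>dual_fun \<alpha> R B x m l' - dual_fun \<alpha> R B x m l - (l' - l) \<bullet> - (B *v w)\<bar>
        \<le> \<alpha> / 2 * K\<^sup>2 * (norm (l' - l))\<^sup>2"
      by (simp add: power_mult_distrib mult_ac)
  qed
qed

text \<open>Let \<open>q\<close> be the component of \<open>w\<close> normal to \<open>T\<close>.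
  Growth of the shifted model around \<open>w\<close> is used twice: towards \<open>y\<close> it
  gains the squared norm of \<open>q\<close> over \<open>2 * \<alpha>\<close>, because
  \<open>y\<close> is at least as far from \<open>w\<close> as \<open>T\<close> is; towards
  \<open>w + q\<close> it controls the multiplier term. In the sum the squares of
  \<open>norm q\<close> cancel exactly and two Lipschitz errors \<open>l * norm q\<close> are left,
  hence the factor 2.\<close>

lemma model_fun_inexact_step:
  fixes T :: "'a::euclidean_space set"
  assumes \<alpha>: "\<alpha> > 0" and Rc: "convex_on UNIV R" and Rl: "l-lipschitz_on UNIV R"
    and T: "subspace T" and m: "m \<in> T" and b: "\<And>t. t \<in> T \<Longrightarrow> b \<bullet> t = 0"
    and w: "\<And>y. model_fun \<alpha> R x (m + b) w \<le> model_fun \<alpha> R x (m + b) y"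
    and y: "y \<in> T" and D: "norm (w - closest_point T w) \<le> D"
  shows "model_fun \<alpha> R x m (closest_point T w) \<le> model_fun \<alpha> R x m y + 2 * l * D"
proof -
  define \<eta> where "\<eta> = closest_point T w"
  define q where "q = w - \<eta>"
  let ?h = "model_fun \<alpha> R x (m + b)"
  have l: "l \<ge> 0" using Rl lipschitz_on_nonneg by blast
  have \<eta>: "\<eta> \<in> T" and orth: "\<And>t. t \<in> T \<Longrightarrow> q \<bullet> t = 0"
    using closest_point_in_subspace[OF T, of w]
      closest_point_subspace_orthogonal[OF T, of _ w] unfolding \<eta>_def q_def by auto
  have w_eq: "w = \<eta> + q" by (simp add: q_def)
  have mq: "m \<bullet> q = 0" and \<eta>q: "\<eta> \<bullet> q = 0" and b\<eta>: "b \<bullet> \<eta> = 0"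
    using orth[OF m] orth[OF \<eta>] b[OF \<eta>] by (auto simp: inner_commute)
  note growth = model_fun_quadratic_growth[OF Rc convex_UNIV UNIV_I UNIV_I w]
  have "norm q \<le> norm (y - w)"
    using closest_point_le[OF closed_subspace[OF T] y, of w]
    by (simp add: q_def \<eta>_def dist_norm norm_minus_commute)
  then have "(norm q)\<^sup>2 / (2 * \<alpha>) \<le> (norm (y - w))\<^sup>2 / (2 * \<alpha>)"
    using \<alpha> by (intro divide_right_mono power_mono) auto
  then have 1: "?h w + (norm q)\<^sup>2 / (2 * \<alpha>) \<le> model_fun \<alpha> R x m y"
    using growth[of y] b[OF y] by (simp add: model_fun_shift)
  \<comment> \<open>The trial point \<open>w + q\<close> lies farther out on the normal through
    \<open>w\<close>. Testing minimality there bounds \<open>- (b \<bullet> q)\<close> with no bound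
    on the norm of the multiplier term \<open>b\<close>.\<close>
  have "(norm (w + q))\<^sup>2 = (norm w)\<^sup>2 + 3 * (norm q)\<^sup>2" and nw: "(norm w)\<^sup>2 = (norm \<eta>)\<^sup>2 + (norm q)\<^sup>2"
    unfolding power2_norm_eq_inner w_eq using \<eta>q
    by (auto simp: inner_add_left inner_add_right inner_commute)
  moreover have "R (x + (w + q)) - R (x + w) \<le> l * norm q"
    using lipschitz_on_real_diff_le[OF Rl, of "x + (w + q)" "x + w"] by (simp add: add.assoc[symmetric])
  ultimately have "?h (w + q) \<le> ?h w + b \<bullet> q + 3 * (norm q)\<^sup>2 / (2 * \<alpha>) + l * norm q"
    using mq by (simp add: model_fun_def inner_add_left inner_add_right add_divide_distrib)
  then have 2: "- (b \<bullet> q) \<le> (norm q)\<^sup>2 / \<alpha> + l * norm q"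
    using growth[of "w + q"] by (simp add: field_simps)
  have "R (x + \<eta>) - R (x + w) \<le> l * norm q"
    using lipschitz_on_real_diff_le[OF Rl, of "x + \<eta>" "x + w"] by (simp add: w_eq)
  then have "model_fun \<alpha> R x m \<eta> + b \<bullet> q + (norm q)\<^sup>2 / (2 * \<alpha>) \<le> ?h w + l * norm q"
    using nw mq b\<eta> w_eq
    by (simp add: model_fun_def inner_add_left inner_add_right add_divide_distrib)
  then have "model_fun \<alpha> R x m \<eta> \<le> model_fun \<alpha> R x m y + 2 * (l * norm q)"
    using 1 2 by (simp add: field_simps)
  moreover have "l * norm q \<le> l * D" using D l by (simp add: q_def \<eta>_def mult_left_mono)
  ultimately show ?thesis by (simp add: \<eta>_def)
qed

text \<open>Comparison with 0 through quadratic growth counts the quadratic term twice, which gives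
  the factor \<alpha> where bare minimality would give \<open>2 * \<alpha>\<close>.\<close>

lemma norm_model_fun_minimizer_le:
  fixes T :: "'a::euclidean_space set"
  assumes \<alpha>: "\<alpha> > 0" and Rc: "convex_on UNIV R" and Rl: "l-lipschitz_on UNIV R"
    and T: "subspace T" "z \<in> T"
    and min: "\<And>y. y \<in> T \<Longrightarrow> model_fun \<alpha> R x m z \<le> model_fun \<alpha> R x m y"
  shows "norm z \<le> \<alpha> * (norm m + l)"
proof (cases "z = 0")
  case False
  have "model_fun \<alpha> R x m z + (norm (0 - z))\<^sup>2 / (2 * \<alpha>) \<le> model_fun \<alpha> R x m 0"
    using model_fun_quadratic_growth[OF Rc subspace_imp_convex[OF T(1)] T(2) subspace_0[OF T(1)] min] .
  moreover have "m \<bullet> z \<ge> - (norm m * norm z)" using Cauchy_Schwarz_ineq2[of m z] by linarith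
  moreover have "R x - R (x + z) \<le> l * norm z"
    using lipschitz_on_real_diff_le[OF Rl, of x "x + z"] by simp
  ultimately have "(norm z)\<^sup>2 / \<alpha> \<le> (norm m + l) * norm z"
    by (simp add: model_fun_def field_simps)
  then have "norm z * norm z \<le> norm z * (\<alpha> * (norm m + l))"
    using \<alpha> by (simp add: field_simps power2_eq_square)
  then show ?thesis using False by simp
qed (use \<alpha> lipschitz_on_nonneg[OF Rl] in auto)

text \<open>\<^const>\<open>C_alpha\<close> is the square of the positive root \<open>t\<close> of
  \<open>(M\<^sub>u + l\<^sub>R) t\<^sup>2 + 2 t sqrt (l\<^sub>R C\<^sub>0 \<Delta>bar) = min \<delta> \<delta>\<^sub>T\<close>.\<close>

lemma C_alpha_bound:
  assumes \<alpha>: "0 < \<alpha>" "\<alpha> \<le> C_alpha l C\<^sub>0 \<Delta>bar M\<^sub>u \<delta> \<delta>\<^sub>T"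
    and pos: "l \<ge> 0" "C\<^sub>0 > 0" "\<Delta>bar \<ge> 0" "M\<^sub>u > 0" "\<delta> > 0" "\<delta>\<^sub>T > 0"
  shows "\<alpha> * (M\<^sub>u + l) + 2 * sqrt (\<alpha> * (l * C\<^sub>0 * \<Delta>bar)) \<le> min \<delta> \<delta>\<^sub>T"
proof -
  define a b d where "a = M\<^sub>u + l" and "b = l * C\<^sub>0 * \<Delta>bar" and "d = min \<delta> \<delta>\<^sub>T"
  have p: "a > 0" "b \<ge> 0" "d > 0" using pos by (auto simp: a_def b_def d_def)
  define t where "t = (sqrt (b + a * d) - sqrt b) / a"
  have t: "t \<ge> 0" using p by (simp add: t_def)
  have st: "sqrt \<alpha> \<le> t"
    using \<alpha>(2) t real_le_lsqrt[of t \<alpha>] \<alpha>(1)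
    by (simp add: C_alpha_def t_def a_def b_def d_def real_le_lsqrt)
  have "(a * t + sqrt b)\<^sup>2 = b + a * d" using p by (simp add: t_def)
  then have "a * (a * t\<^sup>2 + 2 * t * sqrt b) = a * d"
    using p by (simp add: power2_sum power_mult_distrib algebra_simps power2_eq_square)
  then have root: "a * t\<^sup>2 + 2 * t * sqrt b = d" using p by simp
  have "\<alpha> * a + 2 * sqrt (\<alpha> * b) = a * (sqrt \<alpha>)\<^sup>2 + 2 * sqrt \<alpha> * sqrt b"
    using \<alpha>(1) by (simp add: real_sqrt_mult)
  also have "\<dots> \<le> a * t\<^sup>2 + 2 * t * sqrt b"
    using st t p \<alpha>(1) by (intro add_mono mult_mono power_mono) auto
  finally show ?thesis using root by (simp add: a_def b_def d_def)
qed

subsection \<open>One step of the algorithm\<close>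

lemma tangent_space_eq_kernel:
  fixes \<psi> :: "real^'d \<Rightarrow> real^'p"
  assumes "retraction_on M Retr" "closed M" and y: "y \<in> M"
    and "local_defining_function M W \<psi>" "y \<in> W"
    and "\<And>v. infdist v (tangent_space M y) \<le> C * norm (jacobian \<psi> (at y) *v v)"
  shows "tangent_space M y = {v. jacobian \<psi> (at y) *v v = 0}"
proof
  show "tangent_space M y \<subseteq> {v. jacobian \<psi> (at y) *v v = 0}"
    using tangent_space_jacobian assms by blast
  show "{v. jacobian \<psi> (at y) *v v = 0} \<subseteq> tangent_space M y"
  proof
    fix v assume "v \<in> {v. jacobian \<psi> (at y) *v v = 0}"
    then have "infdist v (tangent_space M y) = 0"
      using assms(6)[of v] infdist_nonneg[of v] by (simp add: order_antisym)
    then show "v \<in> tangent_space M y"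
      using in_closed_iff_infdist_zero closed_tangent_space[OF assms(1,2) y]
        zero_in_tangent_space[OF y] by blast
  qed
qed

lemma subspace_kernel_matrix: "subspace {v. (B :: real^'d^'p) *v v = 0}"
  by (auto simp: subspace_def matrix_vector_right_distrib matrix_vector_mult_scaleR)

text \<open>The derivatives of the finitely many defining functions are continuous, so a tangent vector
  at \<open>y\<close> is almost annihilated by the derivative at nearby points, whichever chart \<open>ell\<close> selects.\<close>

lemma infdist_tangent_space_usc:
  fixes \<psi> :: "'i \<Rightarrow> real^'d \<Rightarrow> real^'p"
  assumes "finite I"
    and chart: "\<And>i. i \<in> I \<Longrightarrow> open (V i) \<and> closure (V i) \<subseteq> W i \<and> local_defining_function M (W i) (\<psi> i)"
    and ell: "\<And>y. y \<in> M \<Longrightarrow> ell y \<in> I \<and> y \<in> V (ell y)"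
    and C: "C > 0"
    and dist: "\<And>y v. y \<in> M \<Longrightarrow>
      infdist v (tangent_space M y) \<le> C * norm (jacobian (\<psi> (ell y)) (at y) *v v)"
    and y: "y \<in> M" and a: "infdist v (tangent_space M y) < a"
  shows "\<exists>Z. open Z \<and> y \<in> Z \<and> (\<forall>z\<in>Z \<inter> M. infdist v (tangent_space M z) < a)"
proof -
  have ne: "tangent_space M y \<noteq> {}" using zero_in_tangent_space[OF y] by blast
  then have "(INF p\<in>tangent_space M y. dist v p) < a" using a by (simp add: infdist_def)
  then obtain p where p: "p \<in> tangent_space M y" "dist v p < a"
    using cINF_less_iff[OF ne bdd_below_image_dist] by blast
  \<comment> \<open>Multiplied by \<open>C\<close>, a derivative below \<open>e\<close> at
    \<open>p\<close> becomes a distance below \<open>a - dist v p\<close>, which the triangle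
    inequality can absorb.\<close>
  define e where "e = (a - dist v p) / C"
  have e: "e > 0" using p C by (simp add: e_def)
  \<comment> \<open>If \<open>y\<close> is in the closure of \<open>V i\<close>, it is in
    \<open>W i\<close>, where the derivative is continuous. Otherwise the complement of the closure
    is a neighbourhood of \<open>y\<close> on which the claim is vacuous.\<close>
  have "\<exists>Z. open Z \<and> y \<in> Z \<and> (\<forall>z\<in>Z \<inter> V i. norm (jacobian (\<psi> i) (at z) *v p) < e)" if i: "i \<in> I" for i
  proof (cases "y \<in> closure (V i)")
    case True
    have yW: "y \<in> W i" and ldf: "local_defining_function M (W i) (\<psi> i)" using True chart[OF i] by auto
    note df = local_defining_function_differentiable[OF ldf]
    have oW: "open (W i)" and Ck: "Ck_on (Suc 0) (W i) (\<psi> i)"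
      using ldf unfolding local_defining_function_def smooth_on_def by blast+
    then have "continuous_on (W i) (\<lambda>z. norm (frechet_derivative (\<psi> i) (at z) p))"
      by (auto intro: continuous_on_norm)
    from continuous_open_preimage[OF this oW open_lessThan[of e]]
    have "open (W i \<inter> (\<lambda>z. norm (frechet_derivative (\<psi> i) (at z) p)) -` {..<e})" .
    moreover have "jacobian (\<psi> i) (at y) *v p = 0"
      using tangent_space_jacobian[OF ldf yW p(1)] .
    ultimately show ?thesis using yW df e
      by (intro exI[of _ "W i \<inter> (\<lambda>z. norm (frechet_derivative (\<psi> i) (at z) p)) -` {..<e}"])
        (simp add: jacobian_mult_vec)
  next
    case False
    then show ?thesis using closure_subset[of "V i"]
      by (intro exI[of _ "- closure (V i)"]) auto
  qed
  then obtain Z where Z: "\<And>i. i \<in> I \<Longrightarrow> open (Z i) \<and> y \<in> Z i"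
    "\<And>i z. i \<in> I \<Longrightarrow> z \<in> Z i \<inter> V i \<Longrightarrow> norm (jacobian (\<psi> i) (at z) *v p) < e"
    by metis
  have "infdist v (tangent_space M z) < a" if z: "z \<in> (\<Inter>i\<in>I. Z i) \<inter> M" for z
  proof -
    have "norm (jacobian (\<psi> (ell z)) (at z) *v p) < e" using z ell[of z] Z(2)[of "ell z" z] by auto
    then have "infdist p (tangent_space M z) < C * e"
      using dist[of z p] z C by (smt (verit) IntD2 mult_le_cancel_left_pos)
    moreover have "infdist v (tangent_space M z) \<le> infdist p (tangent_space M z) + dist v p"
      by (rule infdist_triangle)
    ultimately show ?thesis using C by (simp add: e_def)
  qed
  then show ?thesis using Z(1) assms(1) by (intro exI[of _ "\<Inter>i\<in>I. Z i"]) auto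
qed

text \<open>Semicontinuity makes the distances measurable; by Pythagoras and polarisation they determine
  all matrix entries of the orthogonal projections.\<close>

lemma borel_measurable_closest_point_subspace:
  fixes X :: "'o \<Rightarrow> 'b::topological_space" and g :: "'o \<Rightarrow> 'a::euclidean_space"
  assumes T: "\<And>y. y \<in> M \<Longrightarrow> subspace (T y)"
    and usc: "\<And>y v a. y \<in> M \<Longrightarrow> infdist v (T y) < a \<Longrightarrow>
      \<exists>Z. open Z \<and> y \<in> Z \<and> (\<forall>z\<in>Z \<inter> M. infdist v (T z) < a)"
    and X: "X \<in> borel_measurable P" "\<And>\<omega>. \<omega> \<in> space P \<Longrightarrow> X \<omega> \<in> M"
    and g: "g \<in> borel_measurable P"
  shows "(\<lambda>\<omega>. closest_point (T (X \<omega>)) (g \<omega>)) \<in> borel_measurable P"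
proof -
  have [measurable]: "(\<lambda>\<omega>. infdist v (T (X \<omega>))) \<in> borel_measurable P" for v
  proof (rule borel_measurableI_less)
    fix a
    \<comment> \<open>Semicontinuity puts each point of \<open>M\<close> with distance below
      \<open>a\<close> into this open set, so the sublevel set is the preimage of an open
      set.\<close>
    define Z where "Z = \<Union>{Z. open Z \<and> (\<forall>z\<in>Z \<inter> M. infdist v (T z) < a)}"
    have "open Z" by (auto simp: Z_def)
    then have "X -` Z \<inter> space P \<in> sets P" using X(1) by (intro measurable_sets) auto
    moreover have "{\<omega> \<in> space P. infdist v (T (X \<omega>)) < a} = X -` Z \<inter> space P"
      using X(2) usc by (fastforce simp: Z_def)
    ultimately show "{\<omega> \<in> space P. infdist v (T (X \<omega>)) < a} \<in> sets P" by simp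
  qed
  have "(\<lambda>\<omega>. closest_point (T (X \<omega>)) c) \<in> borel_measurable P" for c
  proof (subst borel_measurable_euclidean_space, rule ballI)
    fix b :: 'a
    let ?s = "\<lambda>v \<omega>. (norm v)\<^sup>2 - (infdist v (T (X \<omega>)))\<^sup>2"
    have "(\<lambda>\<omega>. (?s (c + b) \<omega> - ?s (c - b) \<omega>) / 4) \<in> borel_measurable P"
      by measurable
    moreover have "closest_point (T (X \<omega>)) c \<bullet> b = (?s (c + b) \<omega> - ?s (c - b) \<omega>) / 4"
      if "\<omega> \<in> space P" for \<omega>
    proof -
      have S: "subspace (T (X \<omega>))" using T X(2) that by blast
      have s: "?s v \<omega> = closest_point (T (X \<omega>)) v \<bullet> closest_point (T (X \<omega>)) v" for v
        using closest_point_subspace_pythagoras(1)[OF S, of v] by (simp add: dot_square_norm)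
      show ?thesis
        unfolding s closest_point_subspace_add[OF S] closest_point_subspace_diff[OF S]
          closest_point_subspace_self_adjoint(2)[OF S, of c b]
        by (simp add: inner_add_left inner_add_right inner_diff_left inner_diff_right inner_commute)
    qed
    ultimately show "(\<lambda>\<omega>. closest_point (T (X \<omega>)) c \<bullet> b) \<in> borel_measurable P"
      by (subst measurable_cong) assumption+
  qed
  \<comment> \<open>Self-adjointness moves the projection from the random vector
    \<open>g \<omega>\<close> to the constant \<open>c\<close>, the case just settled.\<close>
  then have "(\<lambda>\<omega>. g \<omega> \<bullet> closest_point (T (X \<omega>)) c) \<in> borel_measurable P" for c
    using g by (intro borel_measurable_inner)
  moreover have "closest_point (T (X \<omega>)) (g \<omega>) \<bullet> c = g \<omega> \<bullet> closest_point (T (X \<omega>)) c"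
    if "\<omega> \<in> space P" for \<omega> c
    using closest_point_subspace_self_adjoint(1) T X(2) that by blast
  ultimately show ?thesis
    by (subst borel_measurable_euclidean_space) (simp cong: measurable_cong)
qed

section \<open>Gradient of the smooth part\<close>

lemma GDERIV_gradient:
  fixes f :: "'a::euclidean_space \<Rightarrow> real"
  assumes "f differentiable (at y)"
  shows "GDERIV f y :> gradient f y"
    and "gradient f y = (\<Sum>b\<in>Basis. frechet_derivative f (at y) b *\<^sub>R b)"
proof -
  let ?D = "frechet_derivative f (at y)"
  let ?g = "\<Sum>b\<in>Basis. ?D b *\<^sub>R b"
  have D: "(f has_derivative ?D) (at y)" using assms frechet_derivative_works by blast
  have "?D v = v \<bullet> ?g" for v
  proof -
    have "?D v = ?D (\<Sum>b\<in>Basis. (v \<bullet> b) *\<^sub>R b)" by (simp add: euclidean_representation)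
    also have "\<dots> = (\<Sum>b\<in>Basis. (v \<bullet> b) * ?D b)"
      using has_derivative_linear[OF D] by (simp add: linear_sum linear_scale o_def)
    also have "\<dots> = v \<bullet> ?g" by (simp add: inner_sum_right mult.commute)
    finally show ?thesis .
  qed
  then have G: "GDERIV f y :> ?g" using D unfolding gderiv_def by (metis (no_types, lifting) ext)
  then show "gradient f y = ?g" by (rule gradient_eq)
  then show "GDERIV f y :> gradient f y" using G by simp
qed

lemma continuous_on_gradient:
  fixes f :: "'a::euclidean_space \<Rightarrow> real"
  assumes "Ck_on 1 S f"
  shows "continuous_on S (gradient f)"
proof -
  have d: "\<And>y. y \<in> S \<Longrightarrow> f differentiable (at y)"
    and c: "\<And>v. continuous_on S (\<lambda>y. frechet_derivative f (at y) v)"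
    using assms by auto
  have "continuous_on S (\<lambda>y. \<Sum>b\<in>Basis. frechet_derivative f (at y) b *\<^sub>R b)"
    by (intro continuous_intros c)
  then show ?thesis using GDERIV_gradient(2)[OF d] by (simp cong: continuous_on_cong)
qed

lemma gradient_average:
  fixes f :: "nat \<Rightarrow> 'a::euclidean_space \<Rightarrow> real"
  assumes "\<And>j. j \<in> {1..n} \<Longrightarrow> f j differentiable (at y)"
  shows "GDERIV (\<lambda>y. (1 / real n) * (\<Sum>j=1..n. f j y)) y :> (1 / real n) *\<^sub>R (\<Sum>j=1..n. gradient (f j) y)"
proof -
  have "((\<lambda>y. (1 / real n) * (\<Sum>j=1..n. f j y)) has_derivative
      (\<lambda>v. (1 / real n) * (\<Sum>j=1..n. v \<bullet> gradient (f j) y))) (at y)"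
    using GDERIV_gradient(1)[OF assms] unfolding gderiv_def
    by (intro has_derivative_mult_right has_derivative_sum) auto
  then show ?thesis unfolding gderiv_def by (simp add: inner_sum_right)
qed

text \<open>The bound on \<open>norm \<eta>\<close> shows where \<open>C_alpha\<close> comes from.
  The exact step contributes \<open>\<alpha> * (M\<^sub>u + l)\<close>. The distance to it follows
  from growth around the exact step: an excess of at most
  \<open>2 * l * C\<^sub>0 * \<Delta>bar\<close> in the model value allows a deviation of
  \<open>2 * sqrt (\<alpha> * (l * C\<^sub>0 * \<Delta>bar))\<close>. The sum is the expression
  controlled by \<open>C_alpha_bound\<close>.\<close>

lemma iRPMVR_tangent_step:
  fixes B :: "real^'d^'p" and T :: "(real^'d) set"
  assumes \<alpha>: "0 < \<alpha>" "\<alpha> \<le> C_alpha l C\<^sub>0 \<Delta>bar M\<^sub>u \<delta> \<delta>\<^sub>T"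
    and Rc: "convex_on UNIV R" and Rl: "l-lipschitz_on UNIV R"
    and T: "T = {v. B *v v = 0}" and C\<^sub>0: "C\<^sub>0 > 0" "\<And>v. infdist v T \<le> C\<^sub>0 * norm (B *v v)"
    and m: "m \<in> T" "norm m \<le> M\<^sub>u" and pos: "M\<^sub>u > 0" "\<delta> > 0" "\<delta>\<^sub>T > 0"
    and \<Delta>: "0 \<le> \<Delta>" "\<Delta> \<le> \<Delta>bar"
    and lam: "norm (gradient (dual_fun \<alpha> R B x m) lam) \<le> \<Delta>"
    and w: "w = prox (\<lambda>y. \<alpha> * R y) (x - \<alpha> *\<^sub>R (m + transpose B *v lam)) - x"
    and \<eta>: "\<eta> = closest_point T w"
    and \<eta>hat: "\<eta>hat = arg_min_on (model_fun \<alpha> R x m) T"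
  shows "\<eta> \<in> T" "norm \<eta> \<le> min \<delta> \<delta>\<^sub>T" "norm \<eta>hat \<le> \<alpha> * (M\<^sub>u + l)"
    "model_fun \<alpha> R x m \<eta> + (norm \<eta>hat)\<^sup>2 / (2 * \<alpha>) \<le> model_fun \<alpha> R x m 0 + 2 * l * C\<^sub>0 * \<Delta>"
proof -
  let ?h = "model_fun \<alpha> R x m"
  have sT: "subspace T" unfolding T by (rule subspace_kernel_matrix)
  have cT: "convex T" "closed T" "0 \<in> T"
    using sT subspace_imp_convex closed_subspace subspace_0 by auto
  have l: "l \<ge> 0" using Rl lipschitz_on_nonneg by blast
  show \<eta>T: "\<eta> \<in> T" using closest_point_in_subspace[OF sT] \<eta> by simp
  have \<eta>hatT: "\<eta>hat \<in> T" and min: "\<And>y. y \<in> T \<Longrightarrow> ?h \<eta>hat \<le> ?h y"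
    unfolding \<eta>hat using arg_min_on_model_fun[OF \<alpha>(1) Rl cT(2,3)] by auto
  note growth = model_fun_quadratic_growth[OF Rc cT(1) \<eta>hatT _ min]
  have wmin: "model_fun \<alpha> R x (m + transpose B *v lam) w \<le> model_fun \<alpha> R x (m + transpose B *v lam) y" for y
    unfolding w by (rule prox_minimizes_model_fun[OF \<alpha>(1) Rl])
  have "norm (B *v w) \<le> \<Delta>"
    using lam gradient_dual_fun[OF \<alpha>(1) Rc Rl wmin] by simp
  then have "norm (w - closest_point T w) \<le> C\<^sub>0 * \<Delta>"
    using C\<^sub>0(2)[of w] closest_point_subspace_pythagoras(2)[OF sT, of w] C\<^sub>0(1)
    by (smt (verit) mult_left_mono)
  moreover have "(transpose B *v lam) \<bullet> t = 0" if "t \<in> T" for t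
    using that unfolding inner_transpose_mult_vec by (simp add: T)
  ultimately have step: "?h \<eta> \<le> ?h \<eta>hat + 2 * l * (C\<^sub>0 * \<Delta>)"
    unfolding \<eta> by (intro model_fun_inexact_step[OF \<alpha>(1) Rc Rl sT m(1) _ wmin \<eta>hatT]) auto
  show "?h \<eta> + (norm \<eta>hat)\<^sup>2 / (2 * \<alpha>) \<le> ?h 0 + 2 * l * C\<^sub>0 * \<Delta>"
    using step growth[OF cT(3)] by simp
  have "norm \<eta>hat \<le> \<alpha> * (norm m + l)"
    by (rule norm_model_fun_minimizer_le[OF \<alpha>(1) Rc Rl sT \<eta>hatT min])
  also have "\<dots> \<le> \<alpha> * (M\<^sub>u + l)" using m \<alpha> by simp
  finally show nh: "norm \<eta>hat \<le> \<alpha> * (M\<^sub>u + l)" .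
  have "(norm (\<eta> - \<eta>hat))\<^sup>2 / (2 * \<alpha>) \<le> 2 * l * (C\<^sub>0 * \<Delta>)"
    using growth[OF \<eta>T] step by simp
  also have "\<dots> \<le> 2 * l * (C\<^sub>0 * \<Delta>bar)" using l C\<^sub>0 \<Delta> by (intro mult_left_mono) auto
  finally have "(norm (\<eta> - \<eta>hat))\<^sup>2 \<le> 4 * (\<alpha> * (l * C\<^sub>0 * \<Delta>bar))"
    using \<alpha>(1) by (simp add: field_simps)
  then have "norm (\<eta> - \<eta>hat) \<le> sqrt (4 * (\<alpha> * (l * C\<^sub>0 * \<Delta>bar)))" by (rule real_le_rsqrt)
  also have "\<dots> = 2 * sqrt (\<alpha> * (l * C\<^sub>0 * \<Delta>bar))" by (simp add: real_sqrt_mult)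
  finally have "norm \<eta> \<le> \<alpha> * (M\<^sub>u + l) + 2 * sqrt (\<alpha> * (l * C\<^sub>0 * \<Delta>bar))"
    using nh norm_triangle_sub[of \<eta> \<eta>hat] by simp
  also have "\<dots> \<le> min \<delta> \<delta>\<^sub>T"
    using C_alpha_bound[OF \<alpha> l C\<^sub>0(1) _ pos] \<Delta> by simp
  finally show "norm \<eta> \<le> min \<delta> \<delta>\<^sub>T" .
qed

text \<open>Convexity of \<open>R\<close> along the segment extracts a factor \<gamma>, so the model
  inequality for the undamped step applies. The retraction errors carry the square of \<gamma>,
  estimated by \<gamma>. In the application \<open>g\<close> is the tangential gradient and
  \<open>h\<close> the squared norm of the exact step.\<close>

lemma iRPMVR_descent:
  fixes x x' g m \<eta> :: "'a::euclidean_space"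
  assumes \<alpha>: "0 < \<alpha>" and \<gamma>: "0 < \<gamma>" "\<gamma> \<le> 1" and \<tau>: "\<tau> > 0" and Rc: "convex_on UNIV R"
    and L: "L\<^sub>F > 0" "L\<^sub>R > 0" and D: "D \<ge> 0"
    and F: "F x' - F x - g \<bullet> (\<gamma> *\<^sub>R \<eta>) \<le> L\<^sub>F / 2 * (norm (\<gamma> *\<^sub>R \<eta>))\<^sup>2"
    and R: "\<bar>R x' - R (x + \<gamma> *\<^sub>R \<eta>)\<bar> \<le> L\<^sub>R * (norm (\<gamma> *\<^sub>R \<eta>))\<^sup>2"
    and step: "model_fun \<alpha> R x m \<eta> + h / (2 * \<alpha>) \<le> model_fun \<alpha> R x m 0 + D"
  shows "F x' + R x' \<le> F x + R x
      - (1 / (2 * \<alpha>) - L\<^sub>F / 2 - L\<^sub>R - \<tau> / 2) * \<gamma> * (norm \<eta>)\<^sup>2 - \<gamma> / (2 * \<alpha>) * h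
      + 1 / (2 * \<tau>) * (norm (m - g))\<^sup>2 + D"
proof -
  let ?N = "(norm \<eta>)\<^sup>2" and ?E = "(norm (m - g))\<^sup>2"
  have "R (x + \<gamma> *\<^sub>R \<eta>) \<le> (1 - \<gamma>) * R x + \<gamma> * R (x + \<eta>)"
    using convex_onD[OF Rc, of \<gamma> x "x + \<eta>"] \<gamma> by (simp add: algebra_simps)
  then have "F x' + R x' \<le> F x + R x + \<gamma> * (g \<bullet> \<eta> + R (x + \<eta>) - R x) + (L\<^sub>F / 2 + L\<^sub>R) * (\<gamma>\<^sup>2 * ?N)"
    using F R by (simp add: algebra_simps power_mult_distrib)
  moreover have "(L\<^sub>F / 2 + L\<^sub>R) * (\<gamma>\<^sup>2 * ?N) \<le> (L\<^sub>F / 2 + L\<^sub>R) * (\<gamma> * ?N)"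
    using \<gamma> L by (intro mult_left_mono mult_right_mono) (auto simp: power2_eq_square)
  moreover have "\<gamma> * (g \<bullet> \<eta> + R (x + \<eta>) - R x)
      \<le> \<gamma> * (\<tau> / 2 * ?N + ?E / (2 * \<tau>) + D - ?N / (2 * \<alpha>) - h / (2 * \<alpha>))"
  proof (rule mult_left_mono)
    have "0 \<le> (norm (m - g) - \<tau> * norm \<eta>)\<^sup>2 / (2 * \<tau>)" using \<tau> by simp
    also have "\<dots> = ?E / (2 * \<tau>) + \<tau> / 2 * ?N - norm (m - g) * norm \<eta>"
      using \<tau> by (simp add: power2_eq_square field_simps)
    finally have "norm (m - g) * norm \<eta> \<le> ?E / (2 * \<tau>) + \<tau> / 2 * ?N" by simp
    moreover have "g \<bullet> \<eta> - m \<bullet> \<eta> \<le> norm (m - g) * norm \<eta>"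
      using Cauchy_Schwarz_ineq2[of "m - g" \<eta>] by (simp add: inner_diff_left)
    ultimately show "g \<bullet> \<eta> + R (x + \<eta>) - R x
        \<le> \<tau> / 2 * ?N + ?E / (2 * \<tau>) + D - ?N / (2 * \<alpha>) - h / (2 * \<alpha>)"
      using step by (simp add: model_fun_def)
  qed (use \<gamma> in auto)
  moreover have "\<gamma> * (?E / (2 * \<tau>) + D) \<le> 1 * (?E / (2 * \<tau>) + D)"
    using \<gamma> \<tau> D by (intro mult_right_mono) auto
  ultimately show ?thesis by (simp add: algebra_simps)
qed

subsection \<open>Conditional expectations\<close>

lemma subalgebra_history:
  assumes "\<And>k. S k \<in> measurable P N" "\<And>k. k \<ge> 1 \<Longrightarrow> batch k \<in> measurable P (count_space UNIV)"
    and "\<And>k. x k \<in> borel_measurable P" "\<And>k. mbar k \<in> borel_measurable P"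
    and "\<And>k. u k \<in> borel_measurable P" "\<And>k. lam k \<in> borel_measurable P"
    and "\<And>k. w k \<in> borel_measurable P" "\<And>k. eta k \<in> borel_measurable P"
  shows "subalgebra P (history P N x mbar S batch u lam w eta k)"
proof -
  define G where "G =
    (\<Union>j\<in>{..k}. preimages P borel (x j) \<union> preimages P borel (mbar j) \<union> preimages P N (S j)) \<union>
    (\<Union>j\<in>{1..<k}. preimages P (count_space UNIV) (batch j)) \<union>
    (\<Union>j\<in>{..<k}. preimages P borel (u j) \<union> preimages P borel (lam j) \<union>
                  preimages P borel (w j) \<union> preimages P borel (eta j))"
  have pre: "preimages P N' X \<subseteq> sets P" if "X \<in> measurable P N'" for N' and X :: "_ \<Rightarrow> 'x"
    using that by (auto simp: preimages_def measurable_sets)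
  have G: "G \<subseteq> sets P"
    unfolding G_def Un_subset_iff UN_subset_iff using assms by (auto dest!: pre[THEN subsetD, rotated])
  moreover have "history P N x mbar S batch u lam w eta k = sigma (space P) G"
    unfolding history_def G_def ..
  ultimately show ?thesis
    using sets.sigma_sets_subset[OF G] sets.space_closed[of P]
    by (simp add: subalgebra_def space_measure_of)
qed

text \<open>The index ranges of \<open>history\<close> matter: iterates enter up to and including
  \<open>k\<close>, steps only below \<open>k\<close>.\<close>

lemma borel_measurable_history:
  fixes x :: "nat \<Rightarrow> 'o \<Rightarrow> real^'d"
  shows
  "x k \<in> borel_measurable (history P N x mbar S batch u lam w eta k)"
proof (rule measurableI)
  define G where "G =
    (\<Union>j\<in>{..k}. preimages P borel (x j) \<union> preimages P borel (mbar j) \<union> preimages P N (S j)) \<union>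
    (\<Union>j\<in>{1..<k}. preimages P (count_space UNIV) (batch j)) \<union>
    (\<Union>j\<in>{..<k}. preimages P borel (u j) \<union> preimages P borel (lam j) \<union>
                  preimages P borel (w j) \<union> preimages P borel (eta j))"
  have "history P N x mbar S batch u lam w eta k = sigma (space P) G"
    unfolding history_def G_def ..
  moreover have "G \<subseteq> Pow (space P)" by (auto simp: G_def preimages_def)
  ultimately have H: "sets (history P N x mbar S batch u lam w eta k) = sigma_sets (space P) G"
    "space (history P N x mbar S batch u lam w eta k) = space P"
    by (simp_all add: space_measure_of)
  fix A :: "(real^'d) set" assume "A \<in> sets borel"
  then have "x k -` A \<inter> space P \<in> preimages P borel (x k)" by (auto simp: preimages_def)
  then have "x k -` A \<inter> space P \<in> G" unfolding G_def by blast
  then show "x k -` A \<inter> space (history P N x mbar S batch u lam w eta k)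
      \<in> sets (history P N x mbar S batch u lam w eta k)"
    unfolding H by blast
qed simp

context finite_measure_subalgebra
begin

lemma integrable_bounded:
  fixes f :: "'a \<Rightarrow> real"
  assumes "f \<in> borel_measurable M" "\<And>\<omega>. \<omega> \<in> space M \<Longrightarrow> \<bar>f \<omega>\<bar> \<le> K"
  shows "integrable M f"
  using assms by (intro integrable_const_bound[of _ K]) auto

text \<open>The common bound \<open>K\<close> makes every term and product integrable, so the
  conditional expectation splits termwise and the factor \<open>g\<close>, known to
  \<open>F\<close>, is pulled out.\<close>

lemma real_cond_exp_descent_measurable:
  fixes X Y A H E g d :: "'a \<Rightarrow> real"
  assumes F: "X \<in> borel_measurable F" "g \<in> borel_measurable F" "d \<in> borel_measurable F"
    and meas: "Y \<in> borel_measurable M" "A \<in> borel_measurable M" "H \<in> borel_measurable M"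
      "E \<in> borel_measurable M"
    and bnd: "\<And>\<omega>. \<omega> \<in> space M \<Longrightarrow> \<bar>X \<omega>\<bar> \<le> K \<and> \<bar>Y \<omega>\<bar> \<le> K \<and> \<bar>A \<omega>\<bar> \<le> K \<and> \<bar>H \<omega>\<bar> \<le> K \<and> \<bar>E \<omega>\<bar> \<le> K
      \<and> \<bar>g \<omega>\<bar> \<le> K \<and> \<bar>d \<omega>\<bar> \<le> K"
    and le: "\<And>\<omega>. \<omega> \<in> space M \<Longrightarrow>
      Y \<omega> \<le> X \<omega> - c * g \<omega> * A \<omega> - c' * g \<omega> * H \<omega> + c'' * E \<omega> + d \<omega>"
  shows "AE \<omega> in M. real_cond_exp M F Y \<omega> \<le> X \<omega> - c * g \<omega> * real_cond_exp M F A \<omega>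
    - c' * g \<omega> * real_cond_exp M F H \<omega> + c'' * real_cond_exp M F E \<omega> + d \<omega>"
proof -
  have [measurable]: "X \<in> borel_measurable F" "g \<in> borel_measurable F" "d \<in> borel_measurable F"
    "X \<in> borel_measurable M" "g \<in> borel_measurable M" "d \<in> borel_measurable M"
    "Y \<in> borel_measurable M" "A \<in> borel_measurable M" "H \<in> borel_measurable M" "E \<in> borel_measurable M"
    using F meas measurable_from_subalg[OF subalg] by auto
  have int: "integrable M X" "integrable M Y" "integrable M E" "integrable M d"
    using bnd by (auto intro: integrable_bounded[of _ K])
  have prod: "integrable M (\<lambda>\<omega>. (b * g \<omega>) * f \<omega>)"
    if "f \<in> borel_measurable M" "\<And>\<omega>. \<omega> \<in> space M \<Longrightarrow> \<bar>f \<omega>\<bar> \<le> K" for b f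
  proof (rule integrable_bounded[of _ "\<bar>b\<bar> * K * K"])
    show "\<bar>b * g \<omega> * f \<omega>\<bar> \<le> \<bar>b\<bar> * K * K" if "\<omega> \<in> space M" for \<omega>
      using bnd[OF that] \<open>\<And>\<omega>. \<omega> \<in> space M \<Longrightarrow> \<bar>f \<omega>\<bar> \<le> K\<close>[OF that]
      by (auto simp: abs_mult intro!: mult_mono)
  qed (use that in measurable)
  have intA: "integrable M (\<lambda>\<omega>. ((- c) * g \<omega>) * A \<omega>)" and intH: "integrable M (\<lambda>\<omega>. ((- c') * g \<omega>) * H \<omega>)"
    using prod bnd by auto
  let ?r = "real_cond_exp M F"
  have "AE \<omega> in M. ?r Y \<omega> \<le> ?r (\<lambda>\<omega>. (((X \<omega> + ((- c) * g \<omega>) * A \<omega>) + ((- c') * g \<omega>) * H \<omega>) + c'' * E \<omega>) + d \<omega>) \<omega>"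
    using le int intA intH by (intro real_cond_exp_mono AE_I2) (auto simp: algebra_simps)
  moreover have "AE \<omega> in M. ?r (\<lambda>\<omega>. (((X \<omega> + ((- c) * g \<omega>) * A \<omega>) + ((- c') * g \<omega>) * H \<omega>) + c'' * E \<omega>) + d \<omega>) \<omega>
      = ?r (\<lambda>\<omega>. ((X \<omega> + ((- c) * g \<omega>) * A \<omega>) + ((- c') * g \<omega>) * H \<omega>) + c'' * E \<omega>) \<omega> + ?r d \<omega>"
    using int intA intH by (intro real_cond_exp_add) auto
  moreover have "AE \<omega> in M. ?r (\<lambda>\<omega>. ((X \<omega> + ((- c) * g \<omega>) * A \<omega>) + ((- c') * g \<omega>) * H \<omega>) + c'' * E \<omega>) \<omega>
      = ?r (\<lambda>\<omega>. (X \<omega> + ((- c) * g \<omega>) * A \<omega>) + ((- c') * g \<omega>) * H \<omega>) \<omega> + ?r (\<lambda>\<omega>. c'' * E \<omega>) \<omega>"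
    using int intA intH by (intro real_cond_exp_add) auto
  moreover have "AE \<omega> in M. ?r (\<lambda>\<omega>. (X \<omega> + ((- c) * g \<omega>) * A \<omega>) + ((- c') * g \<omega>) * H \<omega>) \<omega>
      = ?r (\<lambda>\<omega>. X \<omega> + ((- c) * g \<omega>) * A \<omega>) \<omega> + ?r (\<lambda>\<omega>. ((- c') * g \<omega>) * H \<omega>) \<omega>"
    using int intA intH by (intro real_cond_exp_add) auto
  moreover have "AE \<omega> in M. ?r (\<lambda>\<omega>. X \<omega> + ((- c) * g \<omega>) * A \<omega>) \<omega> = ?r X \<omega> + ?r (\<lambda>\<omega>. ((- c) * g \<omega>) * A \<omega>) \<omega>"
    using int intA by (intro real_cond_exp_add) auto
  moreover have "AE \<omega> in M. ?r (\<lambda>\<omega>. ((- c) * g \<omega>) * A \<omega>) \<omega> = ((- c) * g \<omega>) * ?r A \<omega>"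
    by (rule real_cond_exp_mult[OF _ _ intA]) measurable
  moreover have "AE \<omega> in M. ?r (\<lambda>\<omega>. ((- c') * g \<omega>) * H \<omega>) \<omega> = ((- c') * g \<omega>) * ?r H \<omega>"
    by (rule real_cond_exp_mult[OF _ _ intH]) measurable
  moreover have "AE \<omega> in M. ?r (\<lambda>\<omega>. c'' * E \<omega>) \<omega> = c'' * ?r E \<omega>"
    using int by (intro real_cond_exp_cmult)
  moreover have "AE \<omega> in M. ?r X \<omega> = X \<omega>" "AE \<omega> in M. ?r d \<omega> = d \<omega>"
    using int F by (auto intro: real_cond_exp_F_meas)
  ultimately show ?thesis by eventually_elim simp
qed

text \<open>If the nonnegative function \<open>H\<close> is not measurable, \<^const>\<open>real_cond_exp\<close> returns a value
  that is at most \<open>0\<close>, and the inequality without the term of \<open>H\<close> is the stronger one.\<close>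

lemma real_cond_exp_descent:
  fixes X Y A H E g d :: "'a \<Rightarrow> real"
  assumes F: "X \<in> borel_measurable F" "g \<in> borel_measurable F" "d \<in> borel_measurable F"
    and meas: "Y \<in> borel_measurable M" "A \<in> borel_measurable M" "E \<in> borel_measurable M"
    and bnd: "\<And>\<omega>. \<omega> \<in> space M \<Longrightarrow> \<bar>X \<omega>\<bar> \<le> K \<and> \<bar>Y \<omega>\<bar> \<le> K \<and> \<bar>A \<omega>\<bar> \<le> K \<and> \<bar>H \<omega>\<bar> \<le> K \<and> \<bar>E \<omega>\<bar> \<le> K
      \<and> \<bar>g \<omega>\<bar> \<le> K \<and> \<bar>d \<omega>\<bar> \<le> K"
    and nonneg: "c' \<ge> 0" "\<And>\<omega>. H \<omega> \<ge> 0" "\<And>\<omega>. \<omega> \<in> space M \<Longrightarrow> g \<omega> \<ge> 0"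
    and le: "\<And>\<omega>. \<omega> \<in> space M \<Longrightarrow>
      Y \<omega> \<le> X \<omega> - c * g \<omega> * A \<omega> - c' * g \<omega> * H \<omega> + c'' * E \<omega> + d \<omega>"
  shows "AE \<omega> in M. real_cond_exp M F Y \<omega> \<le> X \<omega> - c * g \<omega> * real_cond_exp M F A \<omega>
    - c' * g \<omega> * real_cond_exp M F H \<omega> + c'' * real_cond_exp M F E \<omega> + d \<omega>"
proof (cases "H \<in> borel_measurable M")
  case True
  then show ?thesis using real_cond_exp_descent_measurable[OF F meas(1,2) True meas(3) bnd le] by blast
next
  case False
  have "(\<lambda>\<omega>. ennreal (H \<omega>)) \<notin> borel_measurable M"
  proof
    assume "(\<lambda>\<omega>. ennreal (H \<omega>)) \<in> borel_measurable M"
    then have "(\<lambda>\<omega>. enn2real (ennreal (H \<omega>))) \<in> borel_measurable M" by measurable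
    then show False using False nonneg(2) by (simp add: enn2real_ennreal)
  qed
  \<comment> \<open>For a nonmeasurable argument \<open>nn_cond_exp\<close> is 0 by definition. The
    positive part thus contributes 0, and what remains is minus a nonnegative number.\<close>
  then have H: "real_cond_exp M F H \<omega> \<le> 0" for \<omega>
    by (simp add: real_cond_exp_def nn_cond_exp_def)
  \<comment> \<open>Shaped to fit the measurable case with the zero function in place of
    \<open>H\<close>.\<close>
  have "Y \<omega> \<le> X \<omega> - c * g \<omega> * A \<omega> - 0 * g \<omega> * 0 + c'' * E \<omega> + d \<omega>" if "\<omega> \<in> space M" for \<omega>
  proof -
    have "c' * g \<omega> * H \<omega> \<ge> 0" using nonneg that by simp
    then show ?thesis using le[OF that] by simp
  qed
  from real_cond_exp_descent_measurable[OF F meas(1,2) _ meas(3) _ this, of K] bnd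
  have "AE \<omega> in M. real_cond_exp M F Y \<omega> \<le> X \<omega> - c * g \<omega> * real_cond_exp M F A \<omega>
      - 0 * g \<omega> * real_cond_exp M F (\<lambda>_. 0) \<omega> + c'' * real_cond_exp M F E \<omega> + d \<omega>"
    by fastforce
  moreover have "AE \<omega> in M. c' * g \<omega> * real_cond_exp M F H \<omega> \<le> 0"
    using H nonneg by (intro AE_I2 mult_nonneg_nonpos) auto
  ultimately show ?thesis by eventually_elim simp
qed

end

theorem theorem3p3:
  fixes P :: "'o measure" and N :: "'s measure"
    and M U :: "(real^'d) set"
    and n :: nat
    and f :: "nat \<Rightarrow> real^'d \<Rightarrow> real"
    and F R \<Phi> :: "real^'d \<Rightarrow> real"
    and Retr :: "real^'d \<Rightarrow> real^'d \<Rightarrow> real^'d"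
    and I :: "'i set"
    and V W :: "'i \<Rightarrow> (real^'d) set"
    and \<psi> :: "'i \<Rightarrow> real^'d \<Rightarrow> real^'p"
    and ell :: "real^'d \<Rightarrow> 'i"
    and B :: "real^'d \<Rightarrow> real^'d^'p"
    and l\<^sub>f l\<^sub>R M\<^sub>f c\<^sub>f M\<^sub>u C\<^sub>0 :: real
    and \<delta> C\<^sub>R C\<^sub>Q L\<^sub>R L\<^sub>\<Phi> L\<^sub>F \<delta>\<^sub>T L\<^sub>T :: real
    and \<alpha> \<alpha>bar \<gamma> \<Delta>bar \<chi>bar \<sigma>\<^sub>0 :: real
    and x0 :: "real^'d"
    and est :: "nat \<Rightarrow> real^'d \<Rightarrow> 's \<Rightarrow> nat multiset \<Rightarrow> real^'d"
    and S :: "nat \<Rightarrow> 'o \<Rightarrow> 's"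
    and batch :: "nat \<Rightarrow> 'o \<Rightarrow> nat multiset"
    and gam Delta chi :: "nat \<Rightarrow> 'o \<Rightarrow> real"
    and x u uhat mbar m w eta etahat :: "nat \<Rightarrow> 'o \<Rightarrow> real^'d"
    and lam :: "nat \<Rightarrow> 'o \<Rightarrow> real^'p"
    and Fil :: "nat \<Rightarrow> 'o measure"
    and \<E> :: "nat \<Rightarrow> 'o \<Rightarrow> real"
    and c\<^sub>e \<mu> \<nu> :: real
  (* the manifold, its local defining functions and the retraction *)
  assumes "compact M" and "embedded_submanifold TYPE('p) M"
    and "finite I" and "M \<subseteq> (\<Union>i\<in>I. V i)"
    and "\<And>i. i \<in> I \<Longrightarrow> open (V i) \<and> closure (V i) \<subseteq> W i \<and> local_defining_function M (W i) (\<psi> i)"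
    and "\<And>y. y \<in> M \<Longrightarrow> ell y \<in> I \<and> y \<in> V (ell y)"
    and "\<And>y. y \<in> M \<Longrightarrow> B y = jacobian (\<psi> (ell y)) (at y)"
    and "C\<^sub>0 > 0" and "\<And>y v. y \<in> M \<Longrightarrow> infdist v (tangent_space M y) \<le> C\<^sub>0 * norm (B y *v v)"
    and "retraction_on M Retr"
  (* the objective *)
    and "n \<ge> 1"
    and "\<And>y. F y = (1 / real n) * (\<Sum>j=1..n. f j y)" and "\<And>y. \<Phi> y = F y + R y"
    and "\<And>j. j \<in> {1..n} \<Longrightarrow> Ck_on 1 UNIV (f j)"
    and "open U" and "M \<subseteq> U" and "\<And>j. j \<in> {1..n} \<Longrightarrow> l\<^sub>f-lipschitz_on U (gradient (f j))"
    and "M\<^sub>f > 0" and "\<And>j y. j \<in> {1..n} \<Longrightarrow> y \<in> M \<Longrightarrow> norm (gradient (f j) y) \<le> M\<^sub>f"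
    and "convex_on UNIV R" and "l\<^sub>R-lipschitz_on UNIV R"
  (* the constants attached to the retraction *)
    and "\<delta> > 0" "C\<^sub>R > 0" "C\<^sub>Q > 0" "L\<^sub>R > 0" "L\<^sub>\<Phi> > 0" "L\<^sub>F > 0"
    and "\<And>y \<eta>. y \<in> M \<Longrightarrow> \<eta> \<in> tangent_space M y \<Longrightarrow> norm \<eta> \<le> \<delta> \<Longrightarrow>
           norm (Retr y \<eta> - y) \<le> C\<^sub>R * norm \<eta> \<and>
           norm (Retr y \<eta> - y - \<eta>) \<le> C\<^sub>Q * (norm \<eta>)\<^sup>2 \<and>
           \<bar>R (Retr y \<eta>) - R (y + \<eta>)\<bar> \<le> L\<^sub>R * (norm \<eta>)\<^sup>2 \<and>
           \<bar>\<Phi> (Retr y \<eta>) - \<Phi> (y + \<eta>)\<bar> \<le> L\<^sub>\<Phi> * (norm \<eta>)\<^sup>2 \<and>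
           F (Retr y \<eta>) - F y - rgrad M F y \<bullet> \<eta> \<le> L\<^sub>F / 2 * (norm \<eta>)\<^sup>2"
    and "\<delta>\<^sub>T > 0" "L\<^sub>T > 0"
    and "\<And>h y \<eta>. h \<in> insert F (f ` {1..n}) \<Longrightarrow> y \<in> M \<Longrightarrow> \<eta> \<in> tangent_space M y \<Longrightarrow>
           norm \<eta> \<le> \<delta>\<^sub>T \<Longrightarrow>
           norm (rgrad M h (Retr y \<eta>) - tangent_proj M (Retr y \<eta>) (rgrad M h y)) \<le> L\<^sub>T * norm \<eta>"
  (* the parameters of iRPMVR *)
    and "0 < \<alpha>" "\<alpha> \<le> \<alpha>bar" and "0 < \<gamma>" "\<gamma> \<le> 1" and "0 \<le> \<Delta>bar" and "0 \<le> \<chi>bar" "\<chi>bar < 1"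
    and "c\<^sub>f \<ge> 1" and "M\<^sub>u = c\<^sub>f * M\<^sub>f" and "x0 \<in> M"
  (* random variables and history *)
    and "prob_space P"
    and "\<And>k. S k \<in> measurable P N"
    and "\<And>k. k \<ge> 1 \<Longrightarrow> batch k \<in> measurable P (count_space UNIV)"
    and "\<And>k. x k \<in> borel_measurable P" and "\<And>k. mbar k \<in> borel_measurable P"
    and "\<And>k. u k \<in> borel_measurable P" and "\<And>k. lam k \<in> borel_measurable P"
    and "\<And>k. w k \<in> borel_measurable P" and "\<And>k. eta k \<in> borel_measurable P"
    and "\<And>k. Fil k = history P N x mbar S batch u lam w eta k"
    and "\<And>k. gam k \<in> borel_measurable (Fil k)"
    and "\<And>k. Delta k \<in> borel_measurable (Fil k)"
    and "\<And>k. chi k \<in> borel_measurable (Fil k)"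
    and "\<And>k \<omega>. \<omega> \<in> space P \<Longrightarrow> gam k \<omega> \<in> {\<gamma>..1} \<and> Delta k \<omega> \<in> {0..\<Delta>bar} \<and> chi k \<omega> \<in> {0..\<chi>bar}"
  (* the iteration of iRPMVR *)
    and "\<And>\<omega>. \<omega> \<in> space P \<Longrightarrow> x 0 \<omega> = x0 \<and>
           u 0 \<omega> = rgrad M F x0 \<and> uhat 0 \<omega> = rgrad M F x0 \<and> mbar 0 \<omega> = rgrad M F x0"
    and "\<And>k \<omega>. \<omega> \<in> space P \<Longrightarrow> k \<ge> 1 \<Longrightarrow>
           set_mset (batch k \<omega>) \<subseteq> {1..n} \<and>
           u k \<omega> = est k (x k \<omega>) (S k \<omega>) (batch k \<omega>) \<and>
           u k \<omega> \<in> tangent_space M (x k \<omega>) \<and>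
           uhat k \<omega> = closest_point (cball 0 M\<^sub>u) (u k \<omega>)"
    and "\<And>k \<omega>. \<omega> \<in> space P \<Longrightarrow>
           m k \<omega> = chi k \<omega> *\<^sub>R mbar k \<omega> + (1 - chi k \<omega>) *\<^sub>R uhat k \<omega>"
    and "\<And>k \<omega>. \<omega> \<in> space P \<Longrightarrow>
           norm (gradient (dual_fun \<alpha> R (B (x k \<omega>)) (x k \<omega>) (m k \<omega>)) (lam k \<omega>)) \<le> Delta k \<omega>"
    and "\<And>k \<omega>. \<omega> \<in> space P \<Longrightarrow>
           w k \<omega> = prox (\<lambda>y. \<alpha> * R y)
                      (x k \<omega> - \<alpha> *\<^sub>R (m k \<omega> + transpose (B (x k \<omega>)) *v lam k \<omega>)) - x k \<omega>"
    and "\<And>k \<omega>. \<omega> \<in> space P \<Longrightarrow> eta k \<omega> = tangent_proj M (x k \<omega>) (w k \<omega>)"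
    and "\<And>k \<omega>. \<omega> \<in> space P \<Longrightarrow> x (Suc k) \<omega> = Retr (x k \<omega>) (gam k \<omega> *\<^sub>R eta k \<omega>)"
    and "\<And>k \<omega>. \<omega> \<in> space P \<Longrightarrow> mbar (Suc k) \<omega> = tangent_proj M (x (Suc k) \<omega>) (m k \<omega>)"
    and "\<And>k \<omega>. \<omega> \<in> space P \<Longrightarrow>
           etahat k \<omega> = arg_min_on (model_fun \<alpha> R (x k \<omega>) (m k \<omega>)) (tangent_space M (x k \<omega>))"
  (* the hypotheses of the theorem *)
    and "error_dissipation P Fil (\<lambda>k \<omega>. m k \<omega> - rgrad M F (x k \<omega>)) eta \<E> c\<^sub>e \<mu> \<nu>"
    and "0 < \<alpha>bar"
    and "\<alpha>bar \<le> min (C_alpha l\<^sub>R C\<^sub>0 \<Delta>bar M\<^sub>u \<delta> \<delta>\<^sub>T) (1 / (L\<^sub>F + 2 * L\<^sub>R))"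
    and "\<sigma>\<^sub>0 = 1 / (2 * \<alpha>) - L\<^sub>F / 2 - L\<^sub>R"
  shows "\<forall>k. \<forall>\<tau>>0. AE \<omega> in P.
      real_cond_exp P (Fil k) (\<lambda>\<omega>. \<Phi> (x (Suc k) \<omega>)) \<omega>
        \<le> \<Phi> (x k \<omega>)
          - (\<sigma>\<^sub>0 - \<tau> / 2) * gam k \<omega> * real_cond_exp P (Fil k) (\<lambda>\<omega>. (norm (eta k \<omega>))\<^sup>2) \<omega>
          - gam k \<omega> / (2 * \<alpha>) * real_cond_exp P (Fil k) (\<lambda>\<omega>. (norm (etahat k \<omega>))\<^sup>2) \<omega>
          + c\<^sub>e / (2 * \<tau>) * (\<E> k \<omega> - real_cond_exp P (Fil k) (\<E> (Suc k)) \<omega>)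
          - \<mu> / (2 * \<tau>) * \<E> k \<omega>
          + \<nu> / (2 * \<tau>) * real_cond_exp P (Fil k) (\<lambda>\<omega>. (norm (eta k \<omega>))\<^sup>2) \<omega>
          + 2 * l\<^sub>R * C\<^sub>0 * Delta k \<omega>"
proof (intro allI impI)
  interpret prob_space P by (rule assms(42))
  have cM: "closed M" using assms(1) compact_imp_closed by blast
  have MW: "y \<in> W (ell y)" and ldf: "local_defining_function M (W (ell y)) (\<psi> (ell y))"
    if "y \<in> M" for y
    using assms(5)[of "ell y"] assms(6)[OF that] closure_subset[of "V (ell y)"] by auto
  have distT: "infdist v (tangent_space M y) \<le> C\<^sub>0 * norm (jacobian (\<psi> (ell y)) (at y) *v v)"
    if "y \<in> M" for y v
    using assms(9)[OF that, of v] assms(7)[OF that] by simp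
  have T: "tangent_space M y = {v. B y *v v = 0}" if y: "y \<in> M" for y
    using tangent_space_eq_kernel[OF assms(10) cM y ldf[OF y] MW[OF y] distT[OF y]] assms(7)[OF y]
    by simp
  have sT: "subspace (tangent_space M y)" if "y \<in> M" for y
    unfolding T[OF that] by (rule subspace_kernel_matrix)
  have usc: "\<exists>Z. open Z \<and> y \<in> Z \<and> (\<forall>z\<in>Z \<inter> M. infdist v (tangent_space M z) < a)"
    if "y \<in> M" "infdist v (tangent_space M y) < a" for y v a
    by (rule infdist_tangent_space_usc[OF assms(3) assms(5) assms(6) assms(8) distT that])

  have df: "f j differentiable (at y)" if "j \<in> {1..n}" for j y
    using assms(14)[OF that] by simp
  have F_eq: "F = (\<lambda>y. (1 / real n) * (\<Sum>j=1..n. f j y))" using assms(12) by blast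
  have GF: "GDERIV F y :> (1 / real n) *\<^sub>R (\<Sum>j=1..n. gradient (f j) y)" for y
    unfolding F_eq by (rule gradient_average[OF df])
  have gradF: "gradient F y = (1 / real n) *\<^sub>R (\<Sum>j=1..n. gradient (f j) y)" for y
    by (rule gradient_eq[OF GF])
  have contgF: "continuous_on UNIV (gradient F)"
    unfolding gradF using continuous_on_gradient[OF assms(14)] by (intro continuous_intros) auto
  have contF: "continuous_on UNIV F"
    using GF unfolding gderiv_def
    by (meson continuous_at_imp_continuous_on has_derivative_continuous)
  have contR: "continuous_on UNIV R" using assms(21) lipschitz_on_continuous_on by blast
  have \<Phi>_eq: "\<Phi> = (\<lambda>y. F y + R y)" using assms(13) by blast
  have cont\<Phi>: "continuous_on UNIV \<Phi>"
    unfolding \<Phi>_eq by (intro continuous_intros contF contR)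
  have gradF_le: "norm (gradient F y) \<le> M\<^sub>f" if "y \<in> M" for y
  proof -
    have "norm (\<Sum>j=1..n. gradient (f j) y) \<le> real n * M\<^sub>f"
      using sum_norm_bound[of "{1..n}" "\<lambda>j. gradient (f j) y" M\<^sub>f] assms(19) that by simp
    then show ?thesis using assms(11) by (simp add: gradF field_simps)
  qed
  have Mu: "M\<^sub>u > 0" "M\<^sub>f \<le> M\<^sub>u" using assms(18,39,40) by (auto simp: mult_le_cancel_right1)
  have l\<^sub>R: "l\<^sub>R \<ge> 0" using assms(21) lipschitz_on_nonneg by blast
  have rgradT: "rgrad M F y \<in> tangent_space M y" and rgrad_le: "norm (rgrad M F y) \<le> M\<^sub>u"
    if "y \<in> M" for y
    using closest_point_in_subspace[OF sT[OF that]] gradF_le[OF that] Mu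
      norm_closest_point_subspace_le[OF sT[OF that], of "gradient F y"]
    by (auto simp: rgrad_def tangent_proj_def)
  have \<alpha>C: "\<alpha> \<le> C_alpha l\<^sub>R C\<^sub>0 \<Delta>bar M\<^sub>u \<delta> \<delta>\<^sub>T" using assms(33,67) by simp
  have \<chi>: "0 \<le> chi k \<omega>" "chi k \<omega> \<le> 1" and \<Delta>: "0 \<le> Delta k \<omega>" "Delta k \<omega> \<le> \<Delta>bar"
    and \<gamma>: "0 < gam k \<omega>" "gam k \<omega> \<le> 1" if "\<omega> \<in> space P" for k \<omega>
    using assms(55)[OF that, of k] assms(34,38) by auto

  \<comment> \<open>Momentum and clipped estimator lie in the same tangent space and the same ball,
    hence so does their convex combination. Iteration 0 has no clipping, but
    \<open>c\<^sub>f \<ge> 1\<close> gives \<open>M\<^sub>f \<le> M\<^sub>u\<close>.\<close>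
  have m_inv: "m k \<omega> \<in> tangent_space M (x k \<omega>) \<and> norm (m k \<omega>) \<le> M\<^sub>u"
    if \<omega>: "\<omega> \<in> space P" and xM: "x k \<omega> \<in> M"
      and mbar: "mbar k \<omega> \<in> tangent_space M (x k \<omega>)" "norm (mbar k \<omega>) \<le> M\<^sub>u" for k \<omega>
  proof -
    have "uhat k \<omega> \<in> tangent_space M (x k \<omega>) \<and> norm (uhat k \<omega>) \<le> M\<^sub>u"
    proof (cases k)
      case 0
      then show ?thesis using assms(56)[OF \<omega>] rgradT[OF assms(41)] rgrad_le[OF assms(41)] by simp
    next
      case (Suc k')
      then have u: "u k \<omega> \<in> tangent_space M (x k \<omega>)" "uhat k \<omega> = closest_point (cball 0 M\<^sub>u) (u k \<omega>)"
        using assms(57)[OF \<omega>, of k] by auto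
      have "closest_point (cball 0 M\<^sub>u) (u k \<omega>) \<in> cball 0 M\<^sub>u"
        using Mu by (intro closest_point_in_set) auto
      then show ?thesis
        using u closest_point_cball_in_subspace[OF sT[OF xM] u(1), of M\<^sub>u] Mu by simp
    qed
    moreover from this have "norm (m k \<omega>) \<le> chi k \<omega> * M\<^sub>u + (1 - chi k \<omega>) * M\<^sub>u"
      unfolding assms(58)[OF \<omega>] using \<chi>[OF \<omega>, of k] mbar
      by (intro order_trans[OF norm_triangle_ineq] add_mono) (auto intro: mult_left_mono)
    ultimately show ?thesis
      unfolding assms(58)[OF \<omega>] using mbar sT[OF xM]
      by (auto simp: algebra_simps intro: subspace_add subspace_scale subspace_diff)
  qed
  have step: "eta k \<omega> \<in> tangent_space M (x k \<omega>) \<and> norm (eta k \<omega>) \<le> min \<delta> \<delta>\<^sub>T \<and>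
      norm (etahat k \<omega>) \<le> \<alpha> * (M\<^sub>u + l\<^sub>R) \<and>
      model_fun \<alpha> R (x k \<omega>) (m k \<omega>) (eta k \<omega>) + (norm (etahat k \<omega>))\<^sup>2 / (2 * \<alpha>)
        \<le> model_fun \<alpha> R (x k \<omega>) (m k \<omega>) 0 + 2 * l\<^sub>R * C\<^sub>0 * Delta k \<omega>"
    if \<omega>: "\<omega> \<in> space P" and xM: "x k \<omega> \<in> M"
      and m: "m k \<omega> \<in> tangent_space M (x k \<omega>)" "norm (m k \<omega>) \<le> M\<^sub>u" for k \<omega>
    using iRPMVR_tangent_step[OF assms(32) \<alpha>C assms(20) assms(21) T[OF xM] assms(8) assms(9)[OF xM]
        m Mu(1) assms(22) assms(29) \<Delta>[OF \<omega>] assms(59)[OF \<omega>] assms(60)[OF \<omega>]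
        assms(61)[OF \<omega>, unfolded tangent_proj_def] assms(64)[OF \<omega>]]
    by blast
  \<comment> \<open>The claims must be carried together: the next iterate is in \<open>M\<close>
    only if \<open>eta k\<close> is tangent, which rests on \<open>m k\<close> and so on
    \<open>mbar k\<close>. Transporting the momentum by projection does not increase its
    norm.\<close>
  have inv: "x k \<omega> \<in> M \<and> mbar k \<omega> \<in> tangent_space M (x k \<omega>) \<and> norm (mbar k \<omega>) \<le> M\<^sub>u"
    if \<omega>: "\<omega> \<in> space P" for k \<omega>
  proof (induction k)
    case 0
    then show ?case using assms(56)[OF \<omega>] assms(41) rgradT[OF assms(41)] rgrad_le[OF assms(41)] by simp
  next
    case (Suc k)
    then have mk: "m k \<omega> \<in> tangent_space M (x k \<omega>)" "norm (m k \<omega>) \<le> M\<^sub>u" using m_inv[OF \<omega>] by auto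
    have "eta k \<omega> \<in> tangent_space M (x k \<omega>)" using step[OF \<omega> _ mk] Suc by blast
    then have x': "x (Suc k) \<omega> \<in> M"
      using assms(10) Suc unfolding retraction_on_def assms(62)[OF \<omega>]
      by (simp add: tangent_space_scaleR)
    then show ?case
      using closest_point_in_subspace[OF sT[OF x']] mk(2)
        norm_closest_point_subspace_le[OF sT[OF x'], of "m k \<omega>"]
      by (simp add: assms(63)[OF \<omega>] tangent_proj_def)
  qed
  note xM = inv[THEN conjunct1]
  have m_bnd: "m k \<omega> \<in> tangent_space M (x k \<omega>)" "norm (m k \<omega>) \<le> M\<^sub>u" if "\<omega> \<in> space P" for k \<omega>
    using m_inv[OF that] inv[OF that] by auto
  note step = step[OF _ xM m_bnd]

  fix k :: nat and \<tau> :: real assume \<tau>: "\<tau> > 0"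
  have sub: "subalgebra P (Fil k)"
    unfolding assms(51) by (rule subalgebra_history) (use assms(43-50) in auto)
  interpret finite_measure_subalgebra P "Fil k"
    by unfold_locales (rule sub)
  have uhat: "uhat k \<in> borel_measurable P"
  proof (cases k)
    case 0
    then show ?thesis using assms(56) by (subst measurable_cong[of P _ "\<lambda>_. rgrad M F x0"]) auto
  next
    case (Suc k')
    have "continuous_on UNIV (closest_point (cball (0::real^'d) M\<^sub>u))"
      using Mu by (intro continuous_on_closest_point) auto
    then have "closest_point (cball (0::real^'d) M\<^sub>u) \<in> borel_measurable borel"
      by (rule borel_measurable_continuous_onI)
    then have "(\<lambda>\<omega>. closest_point (cball 0 M\<^sub>u) (u k \<omega>)) \<in> borel_measurable P"
      using assms(47) measurable_compose by blast
    moreover have "uhat k \<omega> = closest_point (cball 0 M\<^sub>u) (u k \<omega>)" if "\<omega> \<in> space P" for \<omega>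
      using assms(57)[OF that, of k] Suc by simp
    ultimately show ?thesis by (subst measurable_cong) assumption+
  qed
  have chi: "chi k \<in> borel_measurable P" using measurable_from_subalg[OF sub assms(54)] .
  have "(\<lambda>\<omega>. chi k \<omega> *\<^sub>R mbar k \<omega> + (1 - chi k \<omega>) *\<^sub>R uhat k \<omega>) \<in> borel_measurable P"
    using chi uhat assms(46) by measurable
  then have m_meas: "m k \<in> borel_measurable P"
    using assms(58) by (subst measurable_cong) assumption+
  have "(\<lambda>\<omega>. gradient F (x k \<omega>)) \<in> borel_measurable P"
    using measurable_compose[OF assms(45) borel_measurable_continuous_onI[OF contgF]] .
  then have "(\<lambda>\<omega>. rgrad M F (x k \<omega>)) \<in> borel_measurable P"
    unfolding rgrad_def tangent_proj_def
    using borel_measurable_closest_point_subspace[OF sT usc assms(45) xM] by blast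
  then have E_meas: "(\<lambda>\<omega>. (norm (m k \<omega> - rgrad M F (x k \<omega>)))\<^sup>2) \<in> borel_measurable P"
    using m_meas by measurable
  have \<Phi>_meas: "(\<lambda>\<omega>. \<Phi> (x k \<omega>)) \<in> borel_measurable (Fil k)"
    "(\<lambda>\<omega>. \<Phi> (x (Suc k) \<omega>)) \<in> borel_measurable P"
    using measurable_compose[OF _ borel_measurable_continuous_onI[OF cont\<Phi>]] assms(45)
      borel_measurable_history unfolding assms(51) by blast+
  have "bounded (\<Phi> ` M)"
    using compact_continuous_image[OF continuous_on_subset[OF cont\<Phi>] assms(1)] compact_imp_bounded
    by blast
  then obtain K\<^sub>\<Phi> where K\<^sub>\<Phi>: "\<And>y. y \<in> M \<Longrightarrow> \<bar>\<Phi> y\<bar> \<le> K\<^sub>\<Phi>"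
    unfolding bounded_iff by auto
  \<comment> \<open>The entries bound, in this order, the objective on \<open>M\<close>, the squared
    step, the squared exact step, the squared error, the damping and the inexactness term.\<close>
  define K where "K = Max {K\<^sub>\<Phi>, \<delta>\<^sup>2, (\<alpha> * (M\<^sub>u + l\<^sub>R))\<^sup>2, (2 * M\<^sub>u)\<^sup>2, 1, 2 * l\<^sub>R * C\<^sub>0 * \<Delta>bar}"
  have K: "K\<^sub>\<Phi> \<le> K" "\<delta>\<^sup>2 \<le> K" "(\<alpha> * (M\<^sub>u + l\<^sub>R))\<^sup>2 \<le> K" "(2 * M\<^sub>u)\<^sup>2 \<le> K" "1 \<le> K"
    "2 * l\<^sub>R * C\<^sub>0 * \<Delta>bar \<le> K"
    by (auto simp: K_def)
  have bnd: "\<bar>\<Phi> (x k \<omega>)\<bar> \<le> K \<and> \<bar>\<Phi> (x (Suc k) \<omega>)\<bar> \<le> K \<and> \<bar>(norm (eta k \<omega>))\<^sup>2\<bar> \<le> K \<and>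
      \<bar>(norm (etahat k \<omega>))\<^sup>2\<bar> \<le> K \<and> \<bar>(norm (m k \<omega> - rgrad M F (x k \<omega>)))\<^sup>2\<bar> \<le> K \<and>
      \<bar>gam k \<omega>\<bar> \<le> K \<and> \<bar>2 * l\<^sub>R * C\<^sub>0 * Delta k \<omega>\<bar> \<le> K" if \<omega>: "\<omega> \<in> space P" for \<omega>
  proof (intro conjI)
    show "\<bar>\<Phi> (x k \<omega>)\<bar> \<le> K" "\<bar>\<Phi> (x (Suc k) \<omega>)\<bar> \<le> K"
      using K\<^sub>\<Phi>[OF xM[OF \<omega>]] K(1) order_trans by blast+
    have "(norm (eta k \<omega>))\<^sup>2 \<le> \<delta>\<^sup>2" "(norm (etahat k \<omega>))\<^sup>2 \<le> (\<alpha> * (M\<^sub>u + l\<^sub>R))\<^sup>2"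
      using step[OF \<omega> \<omega> \<omega> \<omega>, of k] by (auto intro!: power_mono)
    then show "\<bar>(norm (eta k \<omega>))\<^sup>2\<bar> \<le> K" "\<bar>(norm (etahat k \<omega>))\<^sup>2\<bar> \<le> K" using K(2,3) by auto
    have "norm (m k \<omega> - rgrad M F (x k \<omega>)) \<le> 2 * M\<^sub>u"
      using norm_triangle_ineq4[of "m k \<omega>" "rgrad M F (x k \<omega>)"] m_bnd(2)[OF \<omega>, of k]
        rgrad_le[OF xM[OF \<omega>], of k] by simp
    then have "(norm (m k \<omega> - rgrad M F (x k \<omega>)))\<^sup>2 \<le> (2 * M\<^sub>u)\<^sup>2" by (intro power_mono) auto
    then show "\<bar>(norm (m k \<omega> - rgrad M F (x k \<omega>)))\<^sup>2\<bar> \<le> K" using K(4) by simp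
    show "\<bar>gam k \<omega>\<bar> \<le> K" using \<gamma>[OF \<omega>, of k] K(5) by simp
    have "0 \<le> 2 * l\<^sub>R * C\<^sub>0 * Delta k \<omega>" "2 * l\<^sub>R * C\<^sub>0 * Delta k \<omega> \<le> 2 * l\<^sub>R * C\<^sub>0 * \<Delta>bar"
      using \<Delta>[OF \<omega>, of k] l\<^sub>R assms(8) by (auto intro!: mult_left_mono)
    then show "\<bar>2 * l\<^sub>R * C\<^sub>0 * Delta k \<omega>\<bar> \<le> K" using K(6) by simp
  qed
  have le: "\<Phi> (x (Suc k) \<omega>) \<le> \<Phi> (x k \<omega>) - (\<sigma>\<^sub>0 - \<tau> / 2) * gam k \<omega> * (norm (eta k \<omega>))\<^sup>2
      - 1 / (2 * \<alpha>) * gam k \<omega> * (norm (etahat k \<omega>))\<^sup>2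
      + 1 / (2 * \<tau>) * (norm (m k \<omega> - rgrad M F (x k \<omega>)))\<^sup>2 + 2 * l\<^sub>R * C\<^sub>0 * Delta k \<omega>"
    if \<omega>: "\<omega> \<in> space P" for \<omega>
  proof -
    note st = step[OF \<omega> \<omega> \<omega> \<omega>, of k]
    have D: "2 * l\<^sub>R * C\<^sub>0 * Delta k \<omega> \<ge> 0" using \<Delta>[OF \<omega>, of k] l\<^sub>R assms(8) by simp
    \<comment> \<open>Damping by at most 1 keeps the step within the radius \<delta> of the
      retraction estimates.\<close>
    have "norm (gam k \<omega> *\<^sub>R eta k \<omega>) \<le> 1 * norm (eta k \<omega>)"
      using \<gamma>[OF \<omega>, of k] by (simp add: mult_left_le_one_le)
    then have n: "norm (gam k \<omega> *\<^sub>R eta k \<omega>) \<le> \<delta>" using st by simp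
    have t: "gam k \<omega> *\<^sub>R eta k \<omega> \<in> tangent_space M (x k \<omega>)" using st by (simp add: tangent_space_scaleR)
    note retr = assms(28)[OF xM[OF \<omega>] t n, folded assms(62)[OF \<omega>]]
    have "F (x (Suc k) \<omega>) + R (x (Suc k) \<omega>) \<le> F (x k \<omega>) + R (x k \<omega>)
      - (1 / (2 * \<alpha>) - L\<^sub>F / 2 - L\<^sub>R - \<tau> / 2) * gam k \<omega> * (norm (eta k \<omega>))\<^sup>2
      - gam k \<omega> / (2 * \<alpha>) * (norm (etahat k \<omega>))\<^sup>2
      + 1 / (2 * \<tau>) * (norm (m k \<omega> - rgrad M F (x k \<omega>)))\<^sup>2 + 2 * l\<^sub>R * C\<^sub>0 * Delta k \<omega>"
      by (rule iRPMVR_descent[OF assms(32) \<gamma>[OF \<omega>] \<tau> assms(20) assms(27) assms(25) D])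
        (use retr st in blast)+
    then show ?thesis by (simp add: assms(13) assms(68))
  qed
  have "AE \<omega> in P. real_cond_exp P (Fil k) (\<lambda>\<omega>. \<Phi> (x (Suc k) \<omega>)) \<omega>
      \<le> \<Phi> (x k \<omega>) - (\<sigma>\<^sub>0 - \<tau> / 2) * gam k \<omega> * real_cond_exp P (Fil k) (\<lambda>\<omega>. (norm (eta k \<omega>))\<^sup>2) \<omega>
        - 1 / (2 * \<alpha>) * gam k \<omega> * real_cond_exp P (Fil k) (\<lambda>\<omega>. (norm (etahat k \<omega>))\<^sup>2) \<omega>
        + 1 / (2 * \<tau>) * real_cond_exp P (Fil k) (\<lambda>\<omega>. (norm (m k \<omega> - rgrad M F (x k \<omega>)))\<^sup>2) \<omega>
        + 2 * l\<^sub>R * C\<^sub>0 * Delta k \<omega>"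
  proof (rule real_cond_exp_descent[OF \<Phi>_meas(1) assms(52) _ \<Phi>_meas(2) _ E_meas bnd _ _ _ le])
    show "(\<lambda>\<omega>. 2 * l\<^sub>R * C\<^sub>0 * Delta k \<omega>) \<in> borel_measurable (Fil k)" using assms(53) by measurable
    show "(\<lambda>\<omega>. (norm (eta k \<omega>))\<^sup>2) \<in> borel_measurable P" using assms(50) by measurable
  qed (use assms(32) \<gamma> in \<open>auto simp: less_imp_le\<close>)
  moreover have "AE \<omega> in P. real_cond_exp P (Fil k) (\<lambda>\<omega>. (norm (m k \<omega> - rgrad M F (x k \<omega>)))\<^sup>2) \<omega> + \<mu> * \<E> k \<omega>
      \<le> c\<^sub>e * (\<E> k \<omega> - real_cond_exp P (Fil k) (\<E> (Suc k)) \<omega>)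
        + \<nu> * real_cond_exp P (Fil k) (\<lambda>\<omega>. (norm (eta k \<omega>))\<^sup>2) \<omega>"
    using assms(65) unfolding error_dissipation_def by (auto elim: AE_mp)
  ultimately show "AE \<omega> in P.
      real_cond_exp P (Fil k) (\<lambda>\<omega>. \<Phi> (x (Suc k) \<omega>)) \<omega>
        \<le> \<Phi> (x k \<omega>)
          - (\<sigma>\<^sub>0 - \<tau> / 2) * gam k \<omega> * real_cond_exp P (Fil k) (\<lambda>\<omega>. (norm (eta k \<omega>))\<^sup>2) \<omega>
          - gam k \<omega> / (2 * \<alpha>) * real_cond_exp P (Fil k) (\<lambda>\<omega>. (norm (etahat k \<omega>))\<^sup>2) \<omega>
          + c\<^sub>e / (2 * \<tau>) * (\<E> k \<omega> - real_cond_exp P (Fil k) (\<E> (Suc k)) \<omega>)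
          - \<mu> / (2 * \<tau>) * \<E> k \<omega>
          + \<nu> / (2 * \<tau>) * real_cond_exp P (Fil k) (\<lambda>\<omega>. (norm (eta k \<omega>))\<^sup>2) \<omega>
          + 2 * l\<^sub>R * C\<^sub>0 * Delta k \<omega>"
  proof eventually_elim
    case (elim \<omega>)
    let ?e = "real_cond_exp P (Fil k) (\<lambda>\<omega>. (norm (m k \<omega> - rgrad M F (x k \<omega>)))\<^sup>2) \<omega>"
    let ?d = "\<E> k \<omega> - real_cond_exp P (Fil k) (\<E> (Suc k)) \<omega>"
    let ?n = "real_cond_exp P (Fil k) (\<lambda>\<omega>. (norm (eta k \<omega>))\<^sup>2) \<omega>"
    have "1 / (2 * \<tau>) * ?e \<le> 1 / (2 * \<tau>) * (c\<^sub>e * ?d - \<mu> * \<E> k \<omega> + \<nu> * ?n)"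
      using elim(2) \<tau> by (intro mult_left_mono) auto
    also have "\<dots> = c\<^sub>e / (2 * \<tau>) * ?d - \<mu> / (2 * \<tau>) * \<E> k \<omega> + \<nu> / (2 * \<tau>) * ?n"
      using \<tau> by (simp add: field_simps)
    finally show ?case using elim(1) by simp
  qed
qed

end
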